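(* Let $n\in\mathbb N$ and let $\omega=\tau_{n-1}\tau_{n-2}\cdots\tau_1:\mathcal D^n\to\mathcal D^n$ be the iterated Pitman transform. Then: (i) (Isometric equivalence) For every $f\in\mathcal D^n$, $\omega f\sim f$, i.e. $\omega f[(\mathbf x,n)\to(\mathbf y,1)]=f[(\mathbf x,n)\to(\mathbf y,1)]$ for all $k\in\mathbb N$ and all $k$-tuples $\mathbf x,\mathbf y$. (ii) (Idempotence) $\omega^2=\omega$. (iii) (Image) $\omega(\mathcal D^n)=\mathcal D^n_\uparrow=\{f\in\mathcal D^n:\ f_{i+1}(s)\le f_i(s^-)\text{ for all }s\ge0,\ 1\le i\le n-1\}$. (iv) $\omega=W$, where $W$ is the melon map.
   Context: $\mathcal D^n$ is the set of $f=(f_1,\dots,f_n)$ where each $f_i:[0,\infty)\to\mathbb R$ is cadlag (right-continuous with left limits), has no negative jumps ($f_i(x)\ge f_i(x^-)$), and $f_i(0)\ge 0$; by convention $f_i(0^-)=0$. Each $f$ defines a finitely additive signed measure $df$ by $df([x,y]\times\{i\})=f_i(y)-f_i(x^-)$. For $p=(x,\ell)$, $q=(y,m)$ with $0\le x\le y$, $n\ge\ell\ge m\ge1$, a path from $p$ to $q$ is a set $\pi=\bigcup_{i=m}^{\ell}[t_i,t_{i-1}]\times\{i\}$ with $x=t_\ell\le t_{\ell-1}\le\dots\le t_m\le t_{m-1}=y$. $\pi$ is to the left of $\rho$ if for all $(x,\ell)\in\pi$, $(y,m)\in\rho$ we have $\ell\le m$ or $x\le y$. Paths are essentially disjoint if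 their intersection is finite. A disjoint $k$-tuple from $\mathbf p=(p_1,\dots,p_k)$ to $\mathbf q=(q_1,\dots,q_k)$ is $(\pi_1,\dots,\pi_k)$ with $\pi_i$ a path from $p_i$ to $q_i$, $\pi_i$ to the left of $\pi_j$ for $i<j$, pairwise essentially disjoint. $f[\mathbf p\to\mathbf q]=\sup df(\pi_1\cup\dots\cup\pi_k)$ over disjoint $k$-tuples from $\mathbf p$ to $\mathbf q$ ($-\infty$ if none exists). $(\mathbf x,\ell)=((x_1,\ell),\dots,(x_k,\ell))$, where tuples $\mathbf x\in[0,\infty)^k$ of positions are listed in nondecreasing order $x_1\le\dots\le x_k$; $p^k=(p,\dots,p)$; $f[p^0\to q^0]=0$. Melon map: $Wf_k(y)=f[(0,n)^k\to(y,1)^k]-f[(0,n)^{k-1}\to(y,1)^{k-1}]$ for $k=1,\dots,n$. For $n=2$ this is the two-line Pitman transform $W:\mathcal D^2\to\mathcal D^2$, $Wf_1(x)=f[(0,2)\to(x,1)]$, $Wf_2=f_1+f_2-Wf_1$. For $1\le i\le n-1$, $\sigma_i:\mathcal D^n\to\mathcal D^n$ replaces the pair $(f_i,f_{i+1})$ by its two-line Pitman transform $(W(f_i,f_{i+1})_1,W(f_i,f_{i+1})_2)$ and leaves other coordinates unchanged. $\tau_m=\sigma_m\sigma_{m+1}\cdots\sigma_{n-1}$ (composition, rightmost applied first). *)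

theory Defs
  imports "HOL-Analysis.Analysis"
begin

text \<open>
  An element of the space with n lines is a function f with components f 1, ..., f n on
  [0, \<infinity>).  It is represented by a total function that vanishes off these indices and at
  negative positions, so that equality in HOL is equality of elements of the space.
\<close>

definition left_lim :: "(real \<Rightarrow> real) \<Rightarrow> real \<Rightarrow> real" where
  "left_lim g x = (if x \<le> 0 then 0 else Lim (at_left x) g)"

definition cadlag :: "(real \<Rightarrow> real) \<Rightarrow> bool" where
  "cadlag g \<longleftrightarrow> (\<forall>x\<ge>0. continuous (at_right x) g) \<and>
     (\<forall>x>0. \<exists>l. (g \<longlongrightarrow> l) (at_left x))"

definition cadlag_space :: "nat \<Rightarrow> (nat \<Rightarrow> real \<Rightarrow> real) set" where
  "cadlag_space n = {f.
     (\<forall>i\<in>{1..n}. cadlag (f i) \<and> (\<forall>x\<ge>0. f i x \<ge> left_lim (f i) x) \<and> f i 0 \<ge> 0) \<and>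
     (\<forall>i x. i \<notin> {1..n} \<or> x < 0 \<longrightarrow> f i x = 0)}"

definition ordered_space :: "nat \<Rightarrow> (nat \<Rightarrow> real \<Rightarrow> real) set" where
  "ordered_space n = {f \<in> cadlag_space n.
     \<forall>s\<ge>0. \<forall>i. 1 \<le> i \<and> i < n \<longrightarrow> f (Suc i) s \<le> left_lim (f i) s}"

text \<open>
  The ring of sets generated by the segments \<open>[x, y] \<times> {i}\<close>.  As these segments are, together
  with the empty set, closed under intersection, a finitely additive set function on the ring
  is determined by its values on them.
\<close>

inductive_set seg_ring :: "(real \<times> nat) set set" where
  seg: "0 \<le> x \<Longrightarrow> x \<le> y \<Longrightarrow> {x..y} \<times> {i} \<in> seg_ring"
| Un: "A \<in> seg_ring \<Longrightarrow> B \<in> seg_ring \<Longrightarrow> A \<union> B \<in> seg_ring"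
| Diff: "A \<in> seg_ring \<Longrightarrow> B \<in> seg_ring \<Longrightarrow> A - B \<in> seg_ring"

definition is_df :: "(nat \<Rightarrow> real \<Rightarrow> real) \<Rightarrow> ((real \<times> nat) set \<Rightarrow> real) \<Rightarrow> bool" where
  "is_df f \<mu> \<longleftrightarrow> additive seg_ring \<mu> \<and>
     (\<forall>i x y. 0 \<le> x \<longrightarrow> x \<le> y \<longrightarrow> \<mu> ({x..y} \<times> {i}) = f i y - left_lim (f i) x)"

definition df :: "(nat \<Rightarrow> real \<Rightarrow> real) \<Rightarrow> (real \<times> nat) set \<Rightarrow> real" where
  "df f = (SOME \<mu>. is_df f \<mu>)"

text \<open>
  Existence of the measure, by summation by parts: the measure of A is a finite sum over the
  points at which the indicator function of A jumps.
\<close>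

definition in_left :: "(real \<times> nat) set \<Rightarrow> real \<times> nat \<Rightarrow> bool" where
  "in_left A p \<longleftrightarrow> eventually (\<lambda>s. (s, snd p) \<in> A) (at_left (fst p))"

definition in_right :: "(real \<times> nat) set \<Rightarrow> real \<times> nat \<Rightarrow> bool" where
  "in_right A p \<longleftrightarrow> eventually (\<lambda>s. (s, snd p) \<in> A) (at_right (fst p))"

definition jumps :: "(real \<times> nat) set \<Rightarrow> (real \<times> nat) set" where
  "jumps A = {p. in_left A p \<noteq> (p \<in> A) \<or> in_right A p \<noteq> (p \<in> A)}"

definition parts_term :: "(nat \<Rightarrow> real \<Rightarrow> real) \<Rightarrow> (real \<times> nat) set \<Rightarrow> real \<times> nat \<Rightarrow> real" where
  "parts_term f A p =
     left_lim (f (snd p)) (fst p) * (of_bool (in_left A p) - of_bool (p \<in> A)) +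
     f (snd p) (fst p) * (of_bool (p \<in> A) - of_bool (in_right A p))"

definition tame :: "(real \<times> nat) set \<Rightarrow> bool" where
  "tame A \<longleftrightarrow> finite (jumps A) \<and>
     (\<forall>p. eventually (\<lambda>s. ((s, snd p) \<in> A) = in_left A p) (at_left (fst p))) \<and>
     (\<forall>p. eventually (\<lambda>s. ((s, snd p) \<in> A) = in_right A p) (at_right (fst p)))"

lemma in_left_unique:
  assumes "eventually (\<lambda>s. ((s, snd p) \<in> A) = b) (at_left (fst p))"
  shows "in_left A p = b"
proof (cases b)
  case True
  then show ?thesis using assms by (simp add: in_left_def)
next
  case False
  have "\<not> in_left A p"
  proof
    assume "in_left A p"
    with assms have "eventually (\<lambda>s. False) (at_left (fst p))"
      unfolding in_left_def by eventually_elim (use False in auto)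
    then show False by simp
  qed
  then show ?thesis using False by simp
qed

lemma in_right_unique:
  assumes "eventually (\<lambda>s. ((s, snd p) \<in> A) = b) (at_right (fst p))"
  shows "in_right A p = b"
proof (cases b)
  case True
  then show ?thesis using assms by (simp add: in_right_def)
next
  case False
  have "\<not> in_right A p"
  proof
    assume "in_right A p"
    with assms have "eventually (\<lambda>s. False) (at_right (fst p))"
      unfolding in_right_def by eventually_elim (use False in auto)
    then show False by simp
  qed
  then show ?thesis using False by simp
qed

lemma tame_Un:
  assumes "tame A" "tame B"
  shows "in_left (A \<union> B) p = (in_left A p \<or> in_left B p)"
    and "in_right (A \<union> B) p = (in_right A p \<or> in_right B p)"
    and "tame (A \<union> B)"
proof -
  have L: "eventually (\<lambda>s. ((s, snd p) \<in> A \<union> B) = (in_left A p \<or> in_left B p)) (at_left (fst p))" for p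
  proof -
    have "eventually (\<lambda>s. ((s, snd p) \<in> A) = in_left A p) (at_left (fst p))"
      "eventually (\<lambda>s. ((s, snd p) \<in> B) = in_left B p) (at_left (fst p))"
      using assms unfolding tame_def by blast+
    then show ?thesis by eventually_elim auto
  qed
  have R: "eventually (\<lambda>s. ((s, snd p) \<in> A \<union> B) = (in_right A p \<or> in_right B p)) (at_right (fst p))" for p
  proof -
    have "eventually (\<lambda>s. ((s, snd p) \<in> A) = in_right A p) (at_right (fst p))"
      "eventually (\<lambda>s. ((s, snd p) \<in> B) = in_right B p) (at_right (fst p))"
      using assms unfolding tame_def by blast+
    then show ?thesis by eventually_elim auto
  qed
  show l: "in_left (A \<union> B) p = (in_left A p \<or> in_left B p)" for p
    using L by (rule in_left_unique)
  show r: "in_right (A \<union> B) p = (in_right A p \<or> in_right B p)" for p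
    using R by (rule in_right_unique)
  have "jumps (A \<union> B) \<subseteq> jumps A \<union> jumps B"
    by (auto simp: jumps_def l r)
  then have "finite (jumps (A \<union> B))"
    using assms by (meson finite_UnI finite_subset tame_def)
  with L R l r show "tame (A \<union> B)"
    unfolding tame_def by presburger
qed

lemma tame_Diff:
  assumes "tame A" "tame B"
  shows "tame (A - B)"
proof -
  have L: "eventually (\<lambda>s. ((s, snd p) \<in> A - B) = (in_left A p \<and> \<not> in_left B p)) (at_left (fst p))" for p
  proof -
    have "eventually (\<lambda>s. ((s, snd p) \<in> A) = in_left A p) (at_left (fst p))"
      "eventually (\<lambda>s. ((s, snd p) \<in> B) = in_left B p) (at_left (fst p))"
      using assms unfolding tame_def by blast+
    then show ?thesis by eventually_elim auto
  qed
  have R: "eventually (\<lambda>s. ((s, snd p) \<in> A - B) = (in_right A p \<and> \<not> in_right B p)) (at_right (fst p))" for p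
  proof -
    have "eventually (\<lambda>s. ((s, snd p) \<in> A) = in_right A p) (at_right (fst p))"
      "eventually (\<lambda>s. ((s, snd p) \<in> B) = in_right B p) (at_right (fst p))"
      using assms unfolding tame_def by blast+
    then show ?thesis by eventually_elim auto
  qed
  have l: "in_left (A - B) p = (in_left A p \<and> \<not> in_left B p)" for p
    using L by (rule in_left_unique)
  have r: "in_right (A - B) p = (in_right A p \<and> \<not> in_right B p)" for p
    using R by (rule in_right_unique)
  have "jumps (A - B) \<subseteq> jumps A \<union> jumps B"
    by (auto simp: jumps_def l r)
  then have "finite (jumps (A - B))"
    using assms by (meson finite_UnI finite_subset tame_def)
  with L R l r show ?thesis
    unfolding tame_def by presburger
qed

lemma tame_seg:
  assumes "x \<le> (y::real)"
  shows "in_left ({x..y} \<times> {i}) p = (snd p = i \<and> x < fst p \<and> fst p \<le> y)"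
    and "in_right ({x..y} \<times> {i}) p = (snd p = i \<and> x \<le> fst p \<and> fst p < y)"
    and "tame ({x..y} \<times> {i})"
proof -
  let ?A = "{x..y} \<times> {i}"
  have L: "eventually (\<lambda>s. ((s, snd p) \<in> ?A) = (snd p = i \<and> x < fst p \<and> fst p \<le> y)) (at_left (fst p))" for p
  proof (cases "x < fst p")
    case True
    show ?thesis
    proof (cases "fst p \<le> y")
      case True
      show ?thesis using eventually_at_left_real[OF \<open>x < fst p\<close>]
        by (rule eventually_mono) (use True \<open>x < fst p\<close> in auto)
    next
      case False
      then have "y < fst p" by simp
      show ?thesis using eventually_at_left_real[OF \<open>y < fst p\<close>]
        by (rule eventually_mono) (use False in auto)
    qed
  next
    case False
    have "fst p - 1 < fst p" by simp
    show ?thesis using eventually_at_left_real[OF \<open>fst p - 1 < fst p\<close>]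
      by (rule eventually_mono) (use False in auto)
  qed
  have R: "eventually (\<lambda>s. ((s, snd p) \<in> ?A) = (snd p = i \<and> x \<le> fst p \<and> fst p < y)) (at_right (fst p))" for p
  proof (cases "fst p < y")
    case True
    show ?thesis
    proof (cases "x \<le> fst p")
      case True
      show ?thesis using eventually_at_right_real[OF \<open>fst p < y\<close>]
        by (rule eventually_mono) (use True \<open>fst p < y\<close> in auto)
    next
      case False
      then have "fst p < x" by simp
      show ?thesis using eventually_at_right_real[OF \<open>fst p < x\<close>]
        by (rule eventually_mono) (use False in auto)
    qed
  next
    case False
    have "fst p < fst p + 1" by simp
    show ?thesis using eventually_at_right_real[OF \<open>fst p < fst p + 1\<close>]
      by (rule eventually_mono) (use False in auto)
  qed
  show l: "in_left ?A p = (snd p = i \<and> x < fst p \<and> fst p \<le> y)" for p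
    using L by (rule in_left_unique)
  show r: "in_right ?A p = (snd p = i \<and> x \<le> fst p \<and> fst p < y)" for p
    using R by (rule in_right_unique)
  have "jumps ?A \<subseteq> {(x, i), (y, i)}"
    by (auto simp: jumps_def l r)
  then have "finite (jumps ?A)"
    by (rule finite_subset) auto
  with L R l r show "tame ?A"
    unfolding tame_def by presburger
qed

lemma tame_seg_ring: "A \<in> seg_ring \<Longrightarrow> tame A"
  by (induction rule: seg_ring.induct) (auto intro: tame_seg tame_Un(3) tame_Diff)

lemma is_df_parts: "is_df f (\<lambda>A. \<Sum>p\<in>jumps A. parts_term f A p)"
proof -
  let ?m = "\<lambda>A. \<Sum>p\<in>jumps A. parts_term f A p"
  have ext: "?m A = (\<Sum>p\<in>S. parts_term f A p)" if "finite S" "jumps A \<subseteq> S" for A S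
    by (rule sum.mono_neutral_left) (use that in \<open>auto simp: jumps_def parts_term_def\<close>)
  have "additive seg_ring ?m"
    unfolding additive_def
  proof (intro ballI impI)
    fix A B assume AB: "A \<in> seg_ring" "B \<in> seg_ring" "A \<inter> B = {}"
    then have t: "tame A" "tame B" by (auto intro: tame_seg_ring)
    note u = tame_Un[OF t]
    let ?S = "jumps A \<union> jumps B \<union> jumps (A \<union> B)"
    have fin: "finite ?S" using t u(3) by (auto simp: tame_def)
    have l: "\<not> (in_left A p \<and> in_left B p)" for p
    proof
      assume "in_left A p \<and> in_left B p"
      then have "eventually (\<lambda>s. (s, snd p) \<in> A) (at_left (fst p))"
        "eventually (\<lambda>s. (s, snd p) \<in> B) (at_left (fst p))"
        by (auto simp: in_left_def)
      then have "eventually (\<lambda>s. False) (at_left (fst p))"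
        by eventually_elim (use AB(3) in auto)
      then show False by simp
    qed
    have r: "\<not> (in_right A p \<and> in_right B p)" for p
    proof
      assume "in_right A p \<and> in_right B p"
      then have "eventually (\<lambda>s. (s, snd p) \<in> A) (at_right (fst p))"
        "eventually (\<lambda>s. (s, snd p) \<in> B) (at_right (fst p))"
        by (auto simp: in_right_def)
      then have "eventually (\<lambda>s. False) (at_right (fst p))"
        by eventually_elim (use AB(3) in auto)
      then show False by simp
    qed
    have "parts_term f (A \<union> B) p = parts_term f A p + parts_term f B p" for p
    proof -
      have "of_bool (in_left (A \<union> B) p) = (of_bool (in_left A p) + of_bool (in_left B p) :: real)"
        using l[of p] by (auto simp: u(1))
      moreover have "of_bool (in_right (A \<union> B) p) = (of_bool (in_right A p) + of_bool (in_right B p) :: real)"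
        using r[of p] by (auto simp: u(2))
      moreover have "of_bool (p \<in> A \<union> B) = (of_bool (p \<in> A) + of_bool (p \<in> B) :: real)"
        using AB(3) by auto
      ultimately show ?thesis
        unfolding parts_term_def by (simp only: algebra_simps)
    qed
    then have "(\<Sum>p\<in>?S. parts_term f (A \<union> B) p) =
        (\<Sum>p\<in>?S. parts_term f A p) + (\<Sum>p\<in>?S. parts_term f B p)"
      by (simp add: sum.distrib)
    moreover have "?m (A \<union> B) = (\<Sum>p\<in>?S. parts_term f (A \<union> B) p)"
      by (rule ext[OF fin]) auto
    moreover have "?m A = (\<Sum>p\<in>?S. parts_term f A p)"
      by (rule ext[OF fin]) auto
    moreover have "?m B = (\<Sum>p\<in>?S. parts_term f B p)"
      by (rule ext[OF fin]) auto
    ultimately show "?m (A \<union> B) = ?m A + ?m B" by simp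
  qed
  moreover have "?m ({x..y} \<times> {i}) = f i y - left_lim (f i) x" if "x \<le> y" for i x y
  proof -
    have "?m ({x..y} \<times> {i}) = (\<Sum>p\<in>{(x, i), (y, i)}. parts_term f ({x..y} \<times> {i}) p)"
      by (rule ext) (auto simp: jumps_def tame_seg[OF that])
    also have "\<dots> = f i y - left_lim (f i) x"
      unfolding parts_term_def tame_seg[OF that] using that by (cases "x = y") auto
    finally show ?thesis .
  qed
  ultimately show ?thesis unfolding is_df_def by blast
qed

lemma df_properties:
  shows df_additive: "additive seg_ring (df f)"
    and df_seg: "0 \<le> x \<Longrightarrow> x \<le> y \<Longrightarrow> df f ({x..y} \<times> {i}) = f i y - left_lim (f i) x"
proof -
  have "is_df f (df f)"
    unfolding df_def using someI[of "is_df f", OF is_df_parts] by simp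
  then show "additive seg_ring (df f)"
    and "0 \<le> x \<Longrightarrow> x \<le> y \<Longrightarrow> df f ({x..y} \<times> {i}) = f i y - left_lim (f i) x"
    unfolding is_df_def by auto
qed

definition is_path :: "real \<times> nat \<Rightarrow> real \<times> nat \<Rightarrow> (real \<times> nat) set \<Rightarrow> bool" where
  "is_path p q \<pi> \<longleftrightarrow>
     0 \<le> fst p \<and> fst p \<le> fst q \<and> 1 \<le> snd q \<and> snd q \<le> snd p \<and>
     (\<exists>t :: nat \<Rightarrow> real. t (snd p) = fst p \<and> t (snd q - 1) = fst q \<and>
        (\<forall>i\<in>{snd q..snd p}. t i \<le> t (i - 1)) \<and>
        \<pi> = (\<Union>i\<in>{snd q..snd p}. {t i..t (i - 1)} \<times> {i}))"

definition left_of :: "(real \<times> nat) set \<Rightarrow> (real \<times> nat) set \<Rightarrow> bool" where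
  "left_of \<pi> \<rho> \<longleftrightarrow> (\<forall>(x, l)\<in>\<pi>. \<forall>(y, m)\<in>\<rho>. l \<le> m \<or> x \<le> y)"

definition essentially_disjoint :: "(real \<times> nat) set \<Rightarrow> (real \<times> nat) set \<Rightarrow> bool" where
  "essentially_disjoint \<pi> \<rho> \<longleftrightarrow> finite (\<pi> \<inter> \<rho>)"

definition disjoint_tuples ::
    "(real \<times> nat) list \<Rightarrow> (real \<times> nat) list \<Rightarrow> (real \<times> nat) set list set" where
  "disjoint_tuples ps qs = {\<pi>s. length \<pi>s = length ps \<and> length \<pi>s = length qs \<and>
     (\<forall>i<length \<pi>s. is_path (ps ! i) (qs ! i) (\<pi>s ! i)) \<and>
     (\<forall>j<length \<pi>s. \<forall>i<j. left_of (\<pi>s ! i) (\<pi>s ! j) \<and> essentially_disjoint (\<pi>s ! i) (\<pi>s ! j))}"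

text \<open>
  The supremum is taken in the extended reals, where that of the empty set is \<open>-\<infinity>\<close>.  For empty
  lists of endpoints the only tuple is the empty one and the value is 0.
\<close>

definition last_passage ::
    "(nat \<Rightarrow> real \<Rightarrow> real) \<Rightarrow> (real \<times> nat) list \<Rightarrow> (real \<times> nat) list \<Rightarrow> ereal" where
  "last_passage f ps qs = (SUP \<pi>s\<in>disjoint_tuples ps qs. ereal (df f (\<Union>(set \<pi>s))))"

lemma last_passage_Nil: "last_passage f [] [] = 0"
proof -
  have "{0..0} \<times> {0} - {0..0} \<times> {0} \<in> seg_ring"
    by (intro seg_ring.intros) auto
  then have "({} :: (real \<times> nat) set) \<in> seg_ring" by simp
  then have "df f ({} \<union> {}) = df f {} + df f {}"
    using df_additive[of f] unfolding additive_def by blast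
  then have "df f {} = 0" by simp
  moreover have "disjoint_tuples [] [] = {[]}"
    by (auto simp: disjoint_tuples_def)
  ultimately show ?thesis by (simp add: last_passage_def zero_ereal_def)
qed

definition isometric ::
    "nat \<Rightarrow> (nat \<Rightarrow> real \<Rightarrow> real) \<Rightarrow> (nat \<Rightarrow> real \<Rightarrow> real) \<Rightarrow> bool" where
  "isometric n g f \<longleftrightarrow>
     (\<forall>xs ys :: real list. length xs = length ys \<longrightarrow>
        sorted xs \<longrightarrow> sorted ys \<longrightarrow> set xs \<subseteq> {0..} \<longrightarrow> set ys \<subseteq> {0..} \<longrightarrow>
        last_passage g (map (\<lambda>x. (x, n)) xs) (map (\<lambda>y. (y, 1)) ys) =
        last_passage f (map (\<lambda>x. (x, n)) xs) (map (\<lambda>y. (y, 1)) ys))"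

definition melon :: "nat \<Rightarrow> (nat \<Rightarrow> real \<Rightarrow> real) \<Rightarrow> nat \<Rightarrow> real \<Rightarrow> real" where
  "melon n f k y = (if 1 \<le> k \<and> k \<le> n \<and> 0 \<le> y then
     real_of_ereal (last_passage f (replicate k (0, n)) (replicate k (y, 1))) -
     real_of_ereal (last_passage f (replicate (k - 1) (0, n)) (replicate (k - 1) (y, 1)))
     else 0)"

definition pitman :: "(nat \<Rightarrow> real \<Rightarrow> real) \<Rightarrow> nat \<Rightarrow> real \<Rightarrow> real" where
  "pitman f = (let W1 = (\<lambda>x. if 0 \<le> x then real_of_ereal (last_passage f [(0, 2)] [(x, 1)]) else 0)
     in (\<lambda>_ _. 0)(1 := W1, 2 := (\<lambda>x. f 1 x + f 2 x - W1 x)))"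

definition pitman_at :: "nat \<Rightarrow> (nat \<Rightarrow> real \<Rightarrow> real) \<Rightarrow> nat \<Rightarrow> real \<Rightarrow> real" where
  "pitman_at i f = (let g = pitman ((\<lambda>_ _. 0)(1 := f i, 2 := f (Suc i)))
     in f(i := g 1, Suc i := g 2))"

text \<open>\<open>\<tau>\<^sub>m = \<sigma>\<^sub>m \<sigma>\<^sub>m\<^sub>+\<^sub>1 \<cdots> \<sigma>\<^sub>n\<^sub>-\<^sub>1\<close> and \<open>\<omega> = \<tau>\<^sub>n\<^sub>-\<^sub>1 \<cdots> \<tau>\<^sub>1\<close>.\<close>

definition pitman_sweep ::
    "nat \<Rightarrow> nat \<Rightarrow> (nat \<Rightarrow> real \<Rightarrow> real) \<Rightarrow> nat \<Rightarrow> real \<Rightarrow> real" where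
  "pitman_sweep n m = foldr (\<circ>) (map pitman_at [m..<n]) id"

definition iter_pitman :: "nat \<Rightarrow> (nat \<Rightarrow> real \<Rightarrow> real) \<Rightarrow> nat \<Rightarrow> real \<Rightarrow> real" where
  "iter_pitman n = foldr (\<circ>) (map (pitman_sweep n) (rev [1..<n])) id"

end

theory Submission
  imports Defs
begin

text \<open>
  For two lines the transform is an explicit Pitman formula: if M is the running maximum of
  \<open>f 2 z - f 1 (z-)\<close>, then \<open>(f 1, f 2)\<close> becomes \<open>(f 1 + M, f 2 - M)\<close>.  Everything rests on the
  fact that this preserves all multi-path last passage values, and that this is a statement about
  one switching point at a time.

  Disjoint k-tuples of paths are interlacing arrays of switching points
  (\<open>disjoint_tuples_patterns\<close>), and the measure of their union is a sum over lines in which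
  consecutive segments are separated by gaps, a gap of length zero costing nothing
  (\<open>pattern_df\<close>).  For two lines and fixed end points, the interlacing conditions confine each
  switching point to an interval of its own and each gap involves only one of them.  The supremum
  therefore splits into k independent one-dimensional ones.  Passing to \<open>(f 1 + M, f 2 - M)\<close>
  shifts each of these by a constant \<open>D (a + 1) - D a\<close> (\<open>switch_transfer\<close>, which is the usual
  Pitman identity including jumps), and the shifts telescope against the change in the boundary
  terms (\<open>two_line_transfer\<close>).  For n lines, one two-line transform amounts to moving one row of
  the array, with its two neighbours held fixed.  This gives the isometry, also for last passage
  across a block of lines m, ..., n (\<open>pattern_sup_sweeps\<close>).

  The sweep \<open>\<tau>\<^sub>m\<close> builds in line m an upper bound for the weight of a single path from time 0 across
  the block m, ..., n, and later sweeps leave line m alone.  By isometry this bound applies to paths in the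
  output.  The path that follows line m + 1 up to time s and has only the point s on line m
  then says precisely that the output is ordered (\<open>iter_pitman_adjacent\<close>).

  An ordered pair of lines has M = 0, so ordered stacks are fixed; this gives idempotence and the
  image.  For an ordered stack, the best k disjoint paths simply follow the lines 1, ..., k
  (\<open>ordered_pattern_sup\<close>), so it is its own melon.  As the melon depends only on last passage
  values, isometry identifies the output with the melon of the input.
\<close>

section \<open>Cadlag lines and running maxima\<close>

text \<open>
  A line vanishes at negative times and its left limit at 0 is set to 0, so left limits are genuine
  limits at every real time; no case distinction at the origin is left, and \<open>g 0 \<ge> 0\<close>
  becomes the statement that the jump at 0 is not negative.
\<close>

definition line :: "(real \<Rightarrow> real) \<Rightarrow> bool" where
  "line g \<longleftrightarrow> (\<forall>x. (g \<longlongrightarrow> g x) (at_right x)) \<and> (\<forall>x. (g \<longlongrightarrow> left_lim g x) (at_left x)) \<and>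
     (\<forall>x. left_lim g x \<le> g x) \<and> (\<forall>x<0. g x = 0)"

lemma left_lim_eqI:
  assumes "(g \<longlongrightarrow> l) (at_left x)" "x \<le> 0 \<Longrightarrow> l = 0"
  shows "left_lim g x = l"
  using assms tendsto_Lim[OF _ assms(1)] by (auto simp: left_lim_def)

lemma eventually_at_left_I: "a < x \<Longrightarrow> (\<And>z. a < z \<Longrightarrow> z < x \<Longrightarrow> P z) \<Longrightarrow> eventually P (at_left (x::real))"
  using eventually_at_left_field by blast

lemma eventually_at_right_I: "x < b \<Longrightarrow> (\<And>z. x < z \<Longrightarrow> z < b \<Longrightarrow> P z) \<Longrightarrow> eventually P (at_right (x::real))"
  using eventually_at_right_field by blast

lemma tendsto_left_of_zero:
  assumes "\<forall>x<0. g x = (0::real)" "x \<le> (0::real)"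
  shows "(g \<longlongrightarrow> 0) (at_left x)"
proof (rule tendsto_eventually, rule eventually_at_left_I[of "x - 1"])
  show "x - 1 < x" by simp
qed (use assms in auto)

lemma line_iff:
  "line g \<longleftrightarrow> cadlag g \<and> (\<forall>x\<ge>0. left_lim g x \<le> g x) \<and> g 0 \<ge> 0 \<and> (\<forall>x<0. g x = 0)"
proof
  assume *: "line g"
  have "g 0 \<ge> left_lim g 0" using * by (auto simp: line_def)
  then show "cadlag g \<and> (\<forall>x\<ge>0. left_lim g x \<le> g x) \<and> g 0 \<ge> 0 \<and> (\<forall>x<0. g x = 0)"
    using * unfolding line_def cadlag_def continuous_within by (auto simp: left_lim_def[of _ 0])
next
  assume *: "cadlag g \<and> (\<forall>x\<ge>0. left_lim g x \<le> g x) \<and> g 0 \<ge> 0 \<and> (\<forall>x<0. g x = 0)"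
  have "(g \<longlongrightarrow> g x) (at_right x)" for x
  proof (cases "x < 0")
    case True
    have "\<forall>\<^sub>F z in at_right x. g z = g x"
      by (rule eventually_at_right_I[OF True]) (use * True in auto)
    then show ?thesis by (rule tendsto_eventually)
  next
    case False
    then show ?thesis using * by (auto simp: cadlag_def continuous_within)
  qed
  moreover have "(g \<longlongrightarrow> left_lim g x) (at_left x)" for x
  proof (cases "x \<le> 0")
    case True
    then show ?thesis using tendsto_left_of_zero[of g x] * by (simp add: left_lim_def)
  next
    case False
    then obtain l where "(g \<longlongrightarrow> l) (at_left x)" using * unfolding cadlag_def by (meson not_le)
    then show ?thesis using left_lim_eqI[of g l x] False by simp
  qed
  moreover have "left_lim g x \<le> g x" for x
    using * by (cases "x < 0") (auto simp: left_lim_def)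
  ultimately show "line g" using * by (auto simp: line_def)
qed

lemma cadlag_space_iff:
  "f \<in> cadlag_space n \<longleftrightarrow> (\<forall>i\<in>{1..n}. line (f i)) \<and> (\<forall>i. i \<notin> {1..n} \<longrightarrow> f i = (\<lambda>_. 0))"
  unfolding cadlag_space_def line_iff fun_eq_iff by blast

context
  fixes g :: "real \<Rightarrow> real"
  assumes g: "line g"
begin

lemma line_right: "(g \<longlongrightarrow> g x) (at_right x)"
  and line_left: "(g \<longlongrightarrow> left_lim g x) (at_left x)"
  and line_jump: "left_lim g x \<le> g x"
  and line_neg: "x < 0 \<Longrightarrow> g x = 0"
  using g by (auto simp: line_def)

lemma line_bounded: "\<exists>B. \<forall>x\<le>N. \<bar>g x\<bar> \<le> B"
proof -
  let ?P = "\<lambda>a b. \<exists>B. \<forall>x\<in>{a..b}. \<bar>g x\<bar> \<le> B"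
  have "?P (-1) (max N (-1))"
  proof (rule Bolzano)
    fix a b c :: real assume "?P a b" "?P b c"
    then obtain B C where "\<forall>x\<in>{a..b}. \<bar>g x\<bar> \<le> B" "\<forall>x\<in>{b..c}. \<bar>g x\<bar> \<le> C" by blast
    then have "\<forall>x\<in>{a..c}. \<bar>g x\<bar> \<le> max B C" by (force simp: le_max_iff_disj)
    then show "?P a c" by blast
  next
    fix x :: real
    have "\<forall>\<^sub>F z in at_left x. dist (g z) (left_lim g x) < 1" "\<forall>\<^sub>F z in at_right x. dist (g z) (g x) < 1"
      using line_left line_right by (auto intro: tendstoD)
    then obtain a b where a: "a < x" "\<And>z. a < z \<Longrightarrow> z < x \<Longrightarrow> dist (g z) (left_lim g x) < 1"
      and b: "b > x" "\<And>z. x < z \<Longrightarrow> z < b \<Longrightarrow> dist (g z) (g x) < 1"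
      by (force simp: eventually_at_left_field eventually_at_right_field)
    have "\<bar>g z\<bar> \<le> \<bar>left_lim g x\<bar> + \<bar>g x\<bar> + 1" if "a < z" "z < b" for z
      using a(2)[of z] b(2)[of z] that by (cases z x rule: linorder_cases) (auto simp: dist_real_def)
    then have "\<forall>c d. c \<le> x \<and> x \<le> d \<and> d - c < min (x - a) (b - x) \<longrightarrow> ?P c d"
      by (intro allI impI exI[of _ "\<bar>left_lim g x\<bar> + \<bar>g x\<bar> + 1"]) auto
    then show "\<exists>d>0. \<forall>a b. a \<le> x \<and> x \<le> b \<and> b - a < d \<longrightarrow> ?P a b"
      by (intro exI[of _ "min (x - a) (b - x)"]) (use a b in auto)
  qed simp
  then obtain B where B: "\<forall>x\<in>{-1..max N (-1)}. \<bar>g x\<bar> \<le> B" by blast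
  have "\<bar>g x\<bar> \<le> max B 0" if "x \<le> N" for x
    using B[rule_format, of x] line_neg[of x] that by (cases "x < 0") (auto simp: le_max_iff_disj)
  then show ?thesis by blast
qed

lemma left_lim_bounds:
  assumes "a < x" "\<And>z. a < z \<Longrightarrow> z < x \<Longrightarrow> l \<le> g z" "\<And>z. a < z \<Longrightarrow> z < x \<Longrightarrow> g z \<le> u"
  shows "l \<le> left_lim g x" "left_lim g x \<le> u"
proof -
  have "\<forall>\<^sub>F z in at_left x. l \<le> g z" "\<forall>\<^sub>F z in at_left x. g z \<le> u"
    using assms by (auto intro: eventually_at_left_I)
  then show "l \<le> left_lim g x" "left_lim g x \<le> u"
    using tendsto_lowerbound[OF line_left] tendsto_upperbound[OF line_left] by auto
qed

end

lemma left_lim_add: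
  assumes "line f" "line g" shows "left_lim (\<lambda>x. f x + g x) x = left_lim f x + left_lim g x"
  using tendsto_add[OF line_left line_left, OF assms, of x]
  by (rule left_lim_eqI) (simp add: left_lim_def)

lemma left_lim_diff:
  assumes "line f" "line g" shows "left_lim (\<lambda>x. f x - g x) x = left_lim f x - left_lim g x"
  using tendsto_diff[OF line_left line_left, OF assms, of x]
  by (rule left_lim_eqI) (simp add: left_lim_def)

text \<open>
  The index set also contains negative times, where the expression is 0.  The supremum is thus that
  over \<open>[0, y]\<close> when y \<open>\<ge>\<close> 0, since the value at 0 is \<open>f2 0 \<ge> 0\<close>, and it is 0 when y < 0.
\<close>

definition run_max :: "(real \<Rightarrow> real) \<Rightarrow> (real \<Rightarrow> real) \<Rightarrow> real \<Rightarrow> real" where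
  "run_max f1 f2 y = (SUP z\<in>{..y}. f2 z - left_lim f1 z)"

context
  fixes f1 f2 :: "real \<Rightarrow> real" and M \<Phi>
  assumes f1: "line f1" and f2: "line f2"
  defines "M \<equiv> run_max f1 f2" and "\<Phi> \<equiv> \<lambda>z. f2 z - left_lim f1 z"
begin

lemma run_max_bdd: "bdd_above (\<Phi> ` {..y})"
proof -
  obtain B C where B: "\<forall>x\<le>y. \<bar>f1 x\<bar> \<le> B" and C: "\<forall>x\<le>y. \<bar>f2 x\<bar> \<le> C"
    using line_bounded f1 f2 by meson
  have "\<Phi> z \<le> C + B" if "z \<le> y" for z
  proof -
    have "- B \<le> left_lim f1 z"
    proof (rule left_lim_bounds(1)[OF f1, of "z - 1" z "-B" B])
      fix u assume "u < z"
      then have "\<bar>f1 u\<bar> \<le> B" using B that by simp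
      then show "- B \<le> f1 u" "f1 u \<le> B" by auto
    qed simp
    then show ?thesis using C that by (smt (verit) \<Phi>_def)
  qed
  then show ?thesis by (intro bdd_aboveI[of _ "C + B"]) auto
qed

lemma run_max_upper: "z \<le> y \<Longrightarrow> \<Phi> z \<le> M y"
  unfolding M_def run_max_def using cSUP_upper[OF _ run_max_bdd, of z y] by (simp add: \<Phi>_def)

lemma run_max_less: "c < M y \<Longrightarrow> \<exists>z\<le>y. c < \<Phi> z"
  unfolding M_def run_max_def using less_cSUP_iff[OF _ run_max_bdd, of y c] by (auto simp: \<Phi>_def)

lemma run_max_least: "(\<And>z. z \<le> y \<Longrightarrow> \<Phi> z \<le> c) \<Longrightarrow> M y \<le> c"
  using run_max_less[of c y] by (meson not_le)

lemma run_max_mono: "y \<le> y' \<Longrightarrow> M y \<le> M y'"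
  by (meson order_trans run_max_least run_max_upper)

lemma run_max_neg: "y < 0 \<Longrightarrow> M y = 0"
  unfolding M_def run_max_def
  by (subst SUP_cong[of _ "{..y}" _ "\<lambda>_. 0"]) (auto simp: line_neg[OF f2] left_lim_def)

lemma run_max_nonneg: "0 \<le> M y"
proof -
  have "min y (- 1) < 0" by simp
  from run_max_neg[OF this] run_max_mono[of "min y (-1)" y] show ?thesis by simp
qed

lemma run_max_left: "(M \<longlongrightarrow> left_lim M x) (at_left x)"
proof (cases "x \<le> 0")
  case True
  then show ?thesis
    using tendsto_left_of_zero[of M x] run_max_neg by (simp add: left_lim_def)
next
  case False
  have "(M \<longlongrightarrow> (SUP z\<in>{..<x}. M z)) (at_left x)"
  proof (rule order_tendstoI)
    have bdd: "bdd_above (M ` {..<x})"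
      by (rule bdd_aboveI[of _ "M x"]) (auto intro: run_max_mono)
    fix c assume "c < (SUP z\<in>{..<x}. M z)"
    then obtain z where z: "z < x" "c < M z"
      using less_cSUP_iff[OF _ bdd, of c] lessThan_non_empty by blast
    show "\<forall>\<^sub>F z in at_left x. c < M z"
      by (rule eventually_at_left_I[OF z(1)]) (meson z(2) less_imp_le less_le_trans run_max_mono)
  next
    have bdd: "bdd_above (M ` {..<x})"
      by (rule bdd_aboveI[of _ "M x"]) (auto intro: run_max_mono)
    fix c assume "(SUP z\<in>{..<x}. M z) < c"
    then show "\<forall>\<^sub>F z in at_left x. M z < c"
      by (intro eventually_at_left_I[of "x - 1"]) (auto intro: order.strict_trans1[OF cSUP_upper[OF _ bdd]])
  qed
  then show ?thesis using left_lim_eqI[of M _ x] False by simp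
qed

lemma run_max_below_left: "u < x \<Longrightarrow> M u \<le> left_lim M x"
  by (rule tendsto_lowerbound[OF run_max_left eventually_at_left_I[of u]])
     (auto intro: run_max_mono)

lemma run_max_jump: "left_lim M x \<le> M x"
  by (rule tendsto_upperbound[OF run_max_left eventually_at_left_I[of "x - 1"]])
     (auto intro: run_max_mono)

lemma run_max_less_left:
  assumes "c < left_lim M x" shows "\<exists>z<x. c < \<Phi> z"
proof -
  have "\<forall>\<^sub>F z in at_left x. c < M z" using assms run_max_left by (rule order_tendstoD(1)[rotated])
  then obtain b where "b < x" and b: "\<And>z. b < z \<Longrightarrow> z < x \<Longrightarrow> c < M z"
    by (auto simp: eventually_at_left_field)
  then obtain u where "u < x" "c < M u" using dense by blast
  then show ?thesis using run_max_less[of c u] by (meson le_less_trans)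
qed

lemma run_max_step: "M x = max (left_lim M x) (\<Phi> x)"
proof (rule antisym)
  show "M x \<le> max (left_lim M x) (\<Phi> x)"
  proof (rule run_max_least)
    fix z assume "z \<le> x"
    then show "\<Phi> z \<le> max (left_lim M x) (\<Phi> x)"
      using run_max_upper[of z z] run_max_below_left[of z x] by (cases "z = x") auto
  qed
qed (simp add: run_max_jump run_max_upper)

text \<open>
  Just after x, \<open>\<Phi>\<close> is close to \<open>f2 x - f1 x\<close>, which is at most \<open>\<Phi> x\<close> because f1 has no negative
  jumps.  A new maximum can therefore only emerge continuously or be reached at the jump time
  itself.
\<close>

lemma run_max_right: "(M \<longlongrightarrow> M x) (at_right x)"
proof (rule order_tendstoI)
  fix c assume "c < M x"
  then show "\<forall>\<^sub>F z in at_right x. c < M z"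
    by (intro eventually_at_right_I[of x "x + 1"])
       (simp, meson less_imp_le less_le_trans run_max_mono)
next
  fix c assume c: "M x < c"
  define e where "e = (c - M x) / 3"
  have e: "e > 0" using c by (simp add: e_def)
  have "\<forall>\<^sub>F z in at_right x. f1 x - e < f1 z" "\<forall>\<^sub>F z in at_right x. f2 z < f2 x + e"
    by (rule order_tendstoD[OF line_right], fact, simp add: e)+
  then have "\<forall>\<^sub>F z in at_right x. f1 x - e < f1 z \<and> f2 z < f2 x + e"
    by eventually_elim simp
  then obtain b where b: "b > x" "\<And>z. x < z \<Longrightarrow> z < b \<Longrightarrow> f1 x - e < f1 z \<and> f2 z < f2 x + e"
    by (auto simp: eventually_at_right_field)
  have "M z < c" if z: "x < z" "z < b" for z
  proof -
    have "\<Phi> u \<le> M x + 2 * e" if "u \<le> z" for u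
    proof (cases "u \<le> x")
      case True
      then show ?thesis using run_max_upper[of u x] e by simp
    next
      case False
      have "f1 x - e \<le> left_lim f1 u"
        by (rule tendsto_lowerbound[OF line_left[OF f1]])
          (use False b that z in \<open>auto intro!: eventually_at_left_I[of x] simp: less_imp_le\<close>)
      then have "\<Phi> u \<le> f2 x - f1 x + 2 * e" using b(2)[of u] False that z by (simp add: \<Phi>_def)
      also have "\<dots> \<le> \<Phi> x + 2 * e" using line_jump[OF f1, of x] by (simp add: \<Phi>_def)
      finally show ?thesis using run_max_upper[of x x] by simp
    qed
    then have "M z \<le> M x + 2 * e" by (rule run_max_least)
    then show ?thesis using e by (simp add: e_def field_simps)
  qed
  with b(1) show "\<forall>\<^sub>F z in at_right x. M z < c" by (rule eventually_at_right_I)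
qed

lemma run_max_line: "line M"
  unfolding line_def using run_max_right run_max_left run_max_jump run_max_neg by blast

lemma run_max_left_diff: "left_lim f2 x - left_lim f1 x \<le> left_lim M x"
proof (rule tendsto_le[OF _ run_max_left tendsto_diff[OF line_left line_left, OF f2 f1]])
  have "f2 z - f1 z \<le> M z" for z
    using run_max_upper[of z z] line_jump[OF f1, of z] by (simp add: \<Phi>_def)
  then show "\<forall>\<^sub>F z in at_left x. f2 z - f1 z \<le> M z" by simp
qed simp

lemma pitman_top_line: "line (\<lambda>x. f1 x + M x)"
  unfolding line_def left_lim_add[OF f1 run_max_line]
  using line_right[OF f1] line_left[OF f1] line_jump[OF f1] line_neg[OF f1]
    line_right[OF run_max_line] line_left[OF run_max_line] line_jump[OF run_max_line]
    line_neg[OF run_max_line]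
  by (auto intro: tendsto_add add_mono)

text \<open>
  The jump of M at x is at most the jump of f2: a positive jump leads to the value \<open>\<Phi> x\<close>
  and starts from at least the left limit of \<open>f2 - f1\<close>.
\<close>

lemma pitman_bottom_line: "line (\<lambda>x. f2 x - M x)"
proof -
  have "left_lim f2 x - left_lim M x \<le> f2 x - M x" for x
    using run_max_step[of x] run_max_left_diff[of x] line_jump[OF f2, of x] by (auto simp: \<Phi>_def max_def)
  then show ?thesis
    unfolding line_def left_lim_diff[OF f2 run_max_line]
    using line_right[OF f2] line_left[OF f2] line_neg[OF f2]
      line_right[OF run_max_line] line_left[OF run_max_line] line_neg[OF run_max_line]
    by (auto intro: tendsto_diff)
qed

lemma run_max_zero:
  assumes "\<And>z. z \<ge> 0 \<Longrightarrow> f2 z \<le> left_lim f1 z"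
  shows "M = (\<lambda>_. 0)"
proof
  fix y
  have "M y \<le> 0"
    by (rule run_max_least) (smt (verit) \<Phi>_def assms left_lim_def line_neg[OF f2])
  then show "M y = 0" using run_max_nonneg[of y] by simp
qed

end

section \<open>The two-line transform as a reshuffling of switching points\<close>

text \<open>
  The measure of the open interval between two consecutive segments on a line.  Two segments that
  touch share a point, which is counted once in the union; the value 0 for \<open>u = v\<close> takes care of it.
\<close>

definition gap :: "(real \<Rightarrow> real) \<Rightarrow> real \<Rightarrow> real \<Rightarrow> real" where
  "gap g u v = (if u < v then left_lim g v - g u else 0)"

text \<open>
  The contribution of a switching point z from the second line to the first, when the previous
  path leaves the first line at l and the next path enters the second line at r.
\<close>

definition switch_cost :: "(real \<Rightarrow> real) \<Rightarrow> (real \<Rightarrow> real) \<Rightarrow> real \<Rightarrow> real \<Rightarrow> real \<Rightarrow> real" where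
  "switch_cost g1 g2 l r z = gap g1 l z + gap g2 z r"

context
  fixes f1 f2 :: "real \<Rightarrow> real" and M \<Phi> L
  assumes f1: "line f1" and f2: "line f2"
  defines "M \<equiv> run_max f1 f2" and "\<Phi> \<equiv> \<lambda>z. f2 z - left_lim f1 z" and "L \<equiv> left_lim M"
begin

text \<open>
  A point where the running maximum is nearly attained and on whose left it has hardly
  risen above the level A.  It is found near the first time that M exceeds A.  If M jumps over A
  there, it attains its maximum at that time; if M leaves the level A continuously,
  there are near-maximisers shortly after it, with a value close to A.
\<close>

lemma first_crossing:
  assumes "M l \<le> A" "L p \<le> A" "A < M v" "0 < \<epsilon>"
  obtains w where "l < w" "p \<le> w" "w \<le> v" "M w - \<epsilon> \<le> \<Phi> w" "L w \<le> A + \<epsilon>"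
proof -
  define Z where "Z = {u. A < M u}"
  have above: "l < u" "p \<le> u" if "u \<in> Z" for u
    using run_max_mono[OF f1 f2, of u l] run_max_below_left[OF f1 f2, of u p] assms(1,2) that
    by (force simp: Z_def M_def L_def)+
  have bdd: "bdd_below Z" using above(1) by (meson bdd_belowI less_imp_le)
  have ne: "v \<in> Z" using assms(3) by (simp add: Z_def)
  define z where "z = Inf Z"
  have z: "z \<le> v" using cInf_lower[OF ne bdd] by (simp add: z_def)
  have zl: "l \<le> z" "p \<le> z"
    unfolding z_def using ne above by (auto intro!: cInf_greatest intro: less_imp_le)
  have below: "M u \<le> A" if "u < z" for u
    using cInf_lower[OF _ bdd, of u] that by (force simp: z_def Z_def)
  have Lz: "L z \<le> A"
  proof (rule ccontr)
    assume "\<not> L z \<le> A"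
    then obtain u where "u < z" "A < \<Phi> u"
      using run_max_less_left[OF f1 f2, of A z] by (auto simp: L_def M_def \<Phi>_def)
    then show False using run_max_upper[OF f1 f2, of u u] below[of u] by (simp add: M_def \<Phi>_def)
  qed
  show ?thesis
  proof (cases "A < M z")
    case True
    then have "z \<in> Z" by (simp add: Z_def)
    moreover have "M z = \<Phi> z"
      using run_max_step[OF f1 f2, of z] Lz True by (auto simp: M_def \<Phi>_def L_def max_def split: if_splits)
    ultimately show ?thesis using that[of z] above z Lz assms(4) by simp
  next
    case False
    have "\<forall>\<^sub>F u in at_right z. M u < A + \<epsilon>"
      using run_max_right[OF f1 f2, of z] False assms(4) unfolding M_def by (intro order_tendstoD) auto
    then obtain b where b: "z < b" "\<And>u. z < u \<Longrightarrow> u < b \<Longrightarrow> M u < A + \<epsilon>"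
      by (auto simp: eventually_at_right_field)
    have "z < v" using z ne False by (cases "z = v") (auto simp: Z_def)
    then obtain t where t: "z < t" "t < min b v" using dense[of z "min b v"] b(1) by auto
    then obtain s where "s \<in> Z" "s < t" using cInf_lessD[of Z t] ne by (auto simp: z_def)
    then have "A < M t" using run_max_mono[OF f1 f2, of s t] by (simp add: Z_def M_def)
    then obtain w where w: "w \<le> t" "A < \<Phi> w" using run_max_less[OF f1 f2, of A t] by (auto simp: M_def \<Phi>_def)
    have "z < w"
      using run_max_upper[OF f1 f2, of w z] w(2) False by (force simp: M_def \<Phi>_def)
    moreover have "M w < A + \<epsilon>" using b(2) \<open>z < w\<close> w t by simp
    moreover have "L w \<le> M w" using run_max_jump[OF f1 f2] by (simp add: L_def M_def)
    ultimately show ?thesis using that[of w] zl t w by simp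
  qed
qed

lemma gap_pitman:
  "gap (\<lambda>x. f1 x + M x) u v = gap f1 u v + gap M u v"
  "gap (\<lambda>x. f2 x - M x) u v = gap f2 u v - gap M u v"
  using left_lim_add[OF f1 run_max_line[OF f1 f2]] left_lim_diff[OF f2 run_max_line[OF f1 f2]]
  by (auto simp: gap_def M_def)

text \<open>
  Away from the ends the cost of z is a constant minus \<open>\<Phi> z\<close> before the transform, and a constant
  minus \<open>\<Phi> z - M z - M (z-)\<close> after it.  Let A and B be the values of M at the two ends of the
  admissible interval.  The claim is that the two suprema differ by A + B.  Since \<open>A \<le> M (z-)\<close> and
  \<open>\<Phi> z \<le> M z \<le> B\<close>, the supremum after the transform is attained near the point where M first
  exceeds A, with value -A, provided M grows in the interval; the supremum before it
  is then B.  If M is constant there, the transform only shifts the function to be maximised.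

  Which one-sided value of M enters depends on whether an end is a point of the same path or of a
  neighbouring path; maxima and minima of M at the two candidates cover all cases at once.
\<close>

lemma switch_transfer:
  assumes z: "p \<le> z" "l \<le> z" "z \<le> q" "z \<le> r" and "0 < \<epsilon>"
  defines "C \<equiv> max 0 (L r - M q) - max 0 (L p - M l)"
    and "g1 \<equiv> \<lambda>x. f1 x + M x" and "g2 \<equiv> \<lambda>x. f2 x - M x"
  shows "\<exists>w. p \<le> w \<and> l \<le> w \<and> w \<le> q \<and> w \<le> r \<and>
      switch_cost g1 g2 l r w \<le> switch_cost f1 f2 l r z - C + \<epsilon>" (is ?to)
    and "\<exists>w. p \<le> w \<and> l \<le> w \<and> w \<le> q \<and> w \<le> r \<and>
      switch_cost f1 f2 l r w \<le> switch_cost g1 g2 l r z + C + \<epsilon>" (is ?from)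
proof -
  have mono: "M u \<le> M v" if "u \<le> v" for u v using run_max_mono[OF f1 f2 that] by (simp add: M_def)
  have Lb: "M u \<le> L v" if "u < v" for u v
    using run_max_below_left[OF f1 f2 that] by (simp add: M_def L_def)
  have LM: "L u \<le> M u" for u using run_max_jump[OF f1 f2] by (simp add: M_def L_def)
  have up: "\<Phi> u \<le> M u" for u using run_max_upper[OF f1 f2, of u u] by (simp add: M_def \<Phi>_def)
  \<comment> \<open>At z = r the gap on the second line disappears and at z = l the one on the first.
    The modified functions below make the same formula valid at these ends.\<close>
  define \<phi> where "\<phi> u = (if u < r then f2 u else left_lim f2 r) - (if l < u then left_lim f1 u else f1 l)" for u
  define R where "R u = (if u < r then M u else L r)" for u
  define K where "K u = (if l < u then L u else M l)" for u
  define A where "A = max (L p) (M l)"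
  define B where "B = min (M q) (L r)"
  have cost: "switch_cost f1 f2 l r u = left_lim f2 r - f1 l - \<phi> u"
    "switch_cost g1 g2 l r u = left_lim f2 r - f1 l - \<phi> u - (L r - R u) + (K u - M l)"
    if "l \<le> u" "u \<le> r" for u
    unfolding switch_cost_def g1_def g2_def gap_pitman using that
    by (auto simp: gap_def \<phi>_def R_def K_def L_def)
  have C: "C = L r - B - (A - M l)" by (auto simp: C_def A_def B_def)
  have K_ge: "A \<le> K u" if "p \<le> u" "l \<le> u" for u
    using that Lb[of l u] mono[of p u] LM[of p] by (cases "p = u"; cases "l = u") (auto simp: A_def K_def, (use Lb[of p u] in simp)+)
  have R_le: "R u \<le> B" if "u \<le> q" "u \<le> r" for u
    using that mono[of u q] Lb[of u r] LM[of u] by (auto simp: B_def R_def)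
  have \<phi>_le: "\<phi> u \<le> R u" if "l \<le> u" "u \<le> r" for u
    using that up[of u] line_jump[OF f1, of l] run_max_left_diff[OF f1 f2, of r]
    by (auto simp: \<phi>_def R_def \<Phi>_def M_def L_def)
  have inner: "\<phi> u = \<Phi> u" "R u = M u" "K u = L u" if "l < u" "u < r" for u
    using that by (auto simp: \<phi>_def R_def K_def \<Phi>_def)
  show ?from
  proof (cases "B \<le> R z")
    case True
    then show ?thesis using z K_ge[of z] \<open>0 < \<epsilon>\<close> by (intro exI[of _ z]) (simp add: cost C)
  next
    case False
    then have "z < r" "M z < B" using z by (auto simp: R_def B_def split: if_splits)
    \<comment> \<open>Choosing c at least M z forces any point with larger \<Phi> to lie to the right of z.\<close>
    define c where "c = max (M z) (B - \<epsilon>)"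
    have "c < B" using \<open>M z < B\<close> \<open>0 < \<epsilon>\<close> by (simp add: c_def)
    then obtain w where w: "w \<le> q" "w < r" "c < \<Phi> w"
    proof (cases "q < r")
      case True
      then show ?thesis
        using that run_max_less[OF f1 f2, of c q] \<open>c < B\<close> by (force simp: B_def M_def \<Phi>_def)
    next
      case False
      obtain w where "w < r" "c < \<Phi> w"
        using run_max_less_left[OF f1 f2, of c r] \<open>c < B\<close> by (auto simp: B_def L_def M_def \<Phi>_def)
      then show ?thesis using that[of w] False by simp
    qed
    have "z < w" using w(3) up[of w] mono[of w z] by (force simp: c_def)
    then show ?thesis
      using w z \<phi>_le[of z] K_ge[of z] inner[of w]
      by (intro exI[of _ w]) (auto simp: cost C c_def)
  qed
  show ?to
  proof (cases "l = r \<or> B \<le> A")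
    case True
    \<comment> \<open>M does not grow over the interval, or the interval is a single point: keep z.\<close>
    have "K z + R z \<le> A + B"
    proof (cases "l = r")
      case True
      then show ?thesis
        using z mono[of p l] mono[of r q] LM[of p] LM[of r] by (auto simp: A_def B_def K_def R_def)
    next
      case False
      then have "K z \<le> R z" using z LM[of z] by (auto simp: K_def R_def)
      then show ?thesis using R_le[of z] K_ge[of z] z True False by simp
    qed
    then show ?thesis using z \<open>0 < \<epsilon>\<close> by (intro exI[of _ z]) (simp add: cost C)
  next
    case False
    obtain v where v: "v \<le> q" "v < r" "A < M v"
    proof (cases "q < r")
      case True
      then show ?thesis using that[of q] False by (auto simp: B_def min_le_iff_disj)
    next
      case q: False
      have "A < L r" using False by (auto simp: B_def min_le_iff_disj)
      then obtain u where "u < r" "A < \<Phi> u"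
        using run_max_less_left[OF f1 f2, of A r] by (auto simp: L_def M_def \<Phi>_def)
      then show ?thesis using that[of u] up[of u] q by simp
    qed
    obtain w where w: "l < w" "p \<le> w" "w \<le> v" "M w - \<epsilon>/2 \<le> \<Phi> w" "L w \<le> A + \<epsilon>/2"
      using first_crossing[of l A p v "\<epsilon>/2"] v \<open>0 < \<epsilon>\<close> by (auto simp: A_def)
    then show ?thesis
      using v inner[of w] \<phi>_le[of z] R_le[of z] z
      by (intro exI[of _ w]) (auto simp: cost C)
  qed
qed

end

section \<open>Interlacing vectors of switching points\<close>

definition interlace :: "nat \<Rightarrow> (nat \<Rightarrow> real) \<Rightarrow> (nat \<Rightarrow> real) \<Rightarrow> bool" where
  "interlace k x y \<longleftrightarrow> (\<forall>a<k. x a \<le> y a) \<and> (\<forall>a. Suc a < k \<longrightarrow> y a \<le> x (Suc a))"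

text \<open>
  The end of the previous segment.  Before the first segment it is -1, where lines vanish, so that
  the gap in front of the first segment is the left limit at its start.
\<close>

definition prev :: "(nat \<Rightarrow> real) \<Rightarrow> nat \<Rightarrow> real" where
  "prev y a = (case a of 0 \<Rightarrow> -1 | Suc b \<Rightarrow> y b)"

lemma prev_simps [simp]: "prev y 0 = -1" "prev y (Suc a) = y a"
  by (simp_all add: prev_def)

text \<open>
  The measure of the union of the segments from x a to y a, as the measure of the hull without the gaps.
\<close>

definition line_weight :: "(real \<Rightarrow> real) \<Rightarrow> nat \<Rightarrow> (nat \<Rightarrow> real) \<Rightarrow> (nat \<Rightarrow> real) \<Rightarrow> real" where
  "line_weight g k x y = g (prev y k) - (\<Sum>a<k. gap g (prev y a) (x a))"

text \<open>
  A further entry N beyond all switching points makes the last switching point look like the others.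
\<close>

definition closed_by :: "nat \<Rightarrow> real \<Rightarrow> (nat \<Rightarrow> real) \<Rightarrow> nat \<Rightarrow> real" where
  "closed_by k N x a = (if a < k then x a else N)"

text \<open>
  The middle vector z enters only through a sum of terms that each depend on one component.
\<close>

lemma two_line_weight:
  assumes x: "\<And>a. a < k \<Longrightarrow> 0 \<le> x a" and N: "0 \<le> N" "\<And>a. a < k \<Longrightarrow> z a < N"
    and g: "line g1" "line g2"
  shows "line_weight g2 k x z + line_weight g1 k z y =
    g1 (prev y k) + left_lim g2 N - left_lim g2 (closed_by k N x 0) -
    (\<Sum>a<k. switch_cost g1 g2 (prev y a) (closed_by k N x (Suc a)) (z a))"
proof -
  let ?x = "closed_by k N x"
  have "prev z k < N" using N by (cases k) auto
  then have "line_weight g2 k x z = left_lim g2 N - (\<Sum>a<k. gap g2 (prev z a) (?x a)) - gap g2 (prev z k) (?x k)"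
    by (simp add: line_weight_def closed_by_def gap_def)
  also have "\<dots> = left_lim g2 N - (\<Sum>a<Suc k. gap g2 (prev z a) (?x a))" by simp
  also have "\<dots> = left_lim g2 N - gap g2 (-1) (?x 0) - (\<Sum>a<k. gap g2 (z a) (?x (Suc a)))"
    unfolding sum.lessThan_Suc_shift by simp
  also have "gap g2 (-1) (?x 0) = left_lim g2 (?x 0)"
    using x[of 0] N(1) line_neg[OF g(2), of "-1"] by (auto simp: gap_def closed_by_def)
  finally show ?thesis
    by (simp add: line_weight_def switch_cost_def sum.distrib)
qed

text \<open>
  Transfer of single switching points gives transfer of whole vectors, because the ranges of
  different components do not interact.  The shifts are differences of one function D along
  the alternating sequence of end points, so only D at the far ends survives, and the
  assumption on the boundary terms absorbs it.
\<close>

lemma two_line_assemble: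
  assumes x: "\<And>a. a < k \<Longrightarrow> 0 \<le> x a" and "interlace k x z" "interlace k z y" "0 < \<epsilon>"
    and N: "0 \<le> N" "\<And>a. a < k \<Longrightarrow> y a < N"
    and g: "line g1" "line g2" and h: "line h1" "line h2"
    and transfer: "\<And>p l q r z \<epsilon>. p \<le> z \<Longrightarrow> l \<le> z \<Longrightarrow> z \<le> q \<Longrightarrow> z \<le> r \<Longrightarrow> 0 < \<epsilon> \<Longrightarrow>
      \<exists>w. p \<le> w \<and> l \<le> w \<and> w \<le> q \<and> w \<le> r \<and>
        switch_cost h1 h2 l r w \<le> switch_cost g1 g2 l r z - (D r q - D p l) + (\<epsilon>::real)"
    and ends: "\<And>u v. v < N \<Longrightarrow> h1 v + left_lim h2 N - left_lim h2 u + D N v - D u (-1) =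
      g1 v + left_lim g2 N - left_lim g2 u"
  shows "\<exists>w. interlace k x w \<and> interlace k w y \<and>
    line_weight g2 k x z + line_weight g1 k z y - \<epsilon> \<le> line_weight h2 k x w + line_weight h1 k w y"
proof -
  let ?x = "closed_by k N x"
  define \<delta> where "\<delta> = \<epsilon> / (real k + 1)"
  have \<delta>: "0 < \<delta>" using \<open>0 < \<epsilon>\<close> by (simp add: \<delta>_def)
  have z: "x a \<le> z a" "prev y a \<le> z a" "z a \<le> y a" "z a \<le> ?x (Suc a)" "z a < N" if "a < k" for a
  proof -
    show 1: "x a \<le> z a" "z a \<le> y a" using that assms(2,3) by (auto simp: interlace_def)
    show "prev y a \<le> z a"
      using that assms(3) 1 x[of a] by (cases a) (auto simp: interlace_def)
    show "z a < N" using N(2)[OF that] 1 by simp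
    then show "z a \<le> ?x (Suc a)" using assms(2) by (auto simp: interlace_def closed_by_def)
  qed
  have "\<exists>w. x a \<le> w \<and> prev y a \<le> w \<and> w \<le> y a \<and> w \<le> ?x (Suc a) \<and>
     switch_cost h1 h2 (prev y a) (?x (Suc a)) w \<le>
     switch_cost g1 g2 (prev y a) (?x (Suc a)) (z a) - (D (?x (Suc a)) (y a) - D (x a) (prev y a)) + \<delta>"
    if "a < k" for a
    using transfer[OF z(1-4)[OF that] \<delta>] .
  then obtain w where w: "\<And>a. a < k \<Longrightarrow> x a \<le> w a \<and> prev y a \<le> w a \<and> w a \<le> y a \<and> w a \<le> ?x (Suc a)"
    and c: "\<And>a. a < k \<Longrightarrow> switch_cost h1 h2 (prev y a) (?x (Suc a)) (w a) \<le>
     switch_cost g1 g2 (prev y a) (?x (Suc a)) (z a) - (D (?x (Suc a)) (y a) - D (x a) (prev y a)) + \<delta>"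
    by metis
  have inter: "interlace k x w" "interlace k w y"
    unfolding interlace_def using w
    by (auto, metis Suc_lessD closed_by_def, metis prev_simps(2))
  define E where "E a = D (?x a) (prev y a)" for a
  have "(\<Sum>a<k. switch_cost h1 h2 (prev y a) (?x (Suc a)) (w a)) \<le>
    (\<Sum>a<k. switch_cost g1 g2 (prev y a) (?x (Suc a)) (z a) - (E (Suc a) - E a) + \<delta>)"
    by (rule sum_mono) (use c in \<open>auto simp: E_def closed_by_def\<close>)
  also have "\<dots> = (\<Sum>a<k. switch_cost g1 g2 (prev y a) (?x (Suc a)) (z a)) - (E k - E 0) + real k * \<delta>"
    unfolding sum_lessThan_telescope[symmetric, of E] by (simp add: sum.distrib sum_subtractf)
  also have "real k * \<delta> \<le> \<epsilon>" using \<open>0 < \<epsilon>\<close> by (simp add: \<delta>_def field_simps)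
  finally have sum: "(\<Sum>a<k. switch_cost h1 h2 (prev y a) (?x (Suc a)) (w a)) \<le>
     (\<Sum>a<k. switch_cost g1 g2 (prev y a) (?x (Suc a)) (z a)) - (E k - E 0) + \<epsilon>" by simp
  have "w a < N" if "a < k" for a using w[OF that] N(2)[OF that] by linarith
  then have h_eq: "line_weight h2 k x w + line_weight h1 k w y =
    h1 (prev y k) + left_lim h2 N - left_lim h2 (?x 0) -
    (\<Sum>a<k. switch_cost h1 h2 (prev y a) (?x (Suc a)) (w a))"
    by (intro two_line_weight x N(1) h)
  have g_eq: "line_weight g2 k x z + line_weight g1 k z y =
    g1 (prev y k) + left_lim g2 N - left_lim g2 (?x 0) -
    (\<Sum>a<k. switch_cost g1 g2 (prev y a) (?x (Suc a)) (z a))"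
    by (intro two_line_weight x N(1) z(5) g)
  have "prev y k < N" using N by (cases k) auto
  then have "h1 (prev y k) + left_lim h2 N - left_lim h2 (?x 0) + E k - E 0 =
      g1 (prev y k) + left_lim g2 N - left_lim g2 (?x 0)"
    using ends[of "prev y k" "?x 0"] by (simp add: E_def closed_by_def)
  then show ?thesis using inter sum h_eq g_eq by (intro exI[of _ w]) simp
qed

lemma two_line_transfer:
  assumes f: "line f1" "line f2"
    and x: "\<And>a. a < k \<Longrightarrow> 0 \<le> x a" and z: "interlace k x z" "interlace k z y" and "0 < \<epsilon>"
  defines "g1 \<equiv> \<lambda>x. f1 x + run_max f1 f2 x" and "g2 \<equiv> \<lambda>x. f2 x - run_max f1 f2 x"
  shows "\<exists>w. interlace k x w \<and> interlace k w y \<and>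
      line_weight f2 k x z + line_weight f1 k z y - \<epsilon> \<le> line_weight g2 k x w + line_weight g1 k w y"
    and "\<exists>w. interlace k x w \<and> interlace k w y \<and>
      line_weight g2 k x z + line_weight g1 k z y - \<epsilon> \<le> line_weight f2 k x w + line_weight f1 k w y"
proof -
  let ?M = "run_max f1 f2"
  define N where "N = 1 + (\<Sum>a<k. \<bar>y a\<bar>)"
  have N: "0 \<le> N" "\<And>a. a < k \<Longrightarrow> y a < N"
  proof -
    show "0 \<le> N" by (simp add: N_def sum_nonneg)
    fix a assume "a < k"
    then have "\<bar>y a\<bar> \<le> (\<Sum>a<k. \<bar>y a\<bar>)" by (intro member_le_sum) auto
    then show "y a < N" by (simp add: N_def)
  qed
  have g: "line g1" "line g2"
    using pitman_top_line[OF f] pitman_bottom_line[OF f] by (simp_all add: g1_def g2_def)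
  define D where "D u v = max 0 (left_lim ?M u - ?M v)" for u v
  have ends: "g1 v + left_lim g2 N - left_lim g2 u + D N v - D u (-1) =
      f1 v + left_lim f2 N - left_lim f2 u" if "v < N" for u v
  proof -
    have "D N v = left_lim ?M N - ?M v" using run_max_below_left[OF f that] by (simp add: D_def)
    moreover have "?M (u - 1) \<le> left_lim ?M u" by (rule run_max_below_left[OF f]) simp
    then have "D u (-1) = left_lim ?M u"
      using run_max_neg[OF f, of "-1"] run_max_nonneg[OF f, of "u - 1"] by (simp add: D_def)
    ultimately show ?thesis
      by (simp add: g1_def g2_def left_lim_diff[OF f(2) run_max_line[OF f]])
  qed
  show "\<exists>w. interlace k x w \<and> interlace k w y \<and>
      line_weight f2 k x z + line_weight f1 k z y - \<epsilon> \<le> line_weight g2 k x w + line_weight g1 k w y"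
  proof (rule two_line_assemble[OF x z \<open>0 < \<epsilon>\<close> N f g, where D = D])
    fix p l q r z \<epsilon> :: real assume "p \<le> z" "l \<le> z" "z \<le> q" "z \<le> r" "0 < \<epsilon>"
    from switch_transfer(1)[OF f this]
    show "\<exists>w. p \<le> w \<and> l \<le> w \<and> w \<le> q \<and> w \<le> r \<and>
        switch_cost g1 g2 l r w \<le> switch_cost f1 f2 l r z - (D r q - D p l) + \<epsilon>"
      by (simp add: g1_def g2_def D_def)
  qed (use ends in auto)
  show "\<exists>w. interlace k x w \<and> interlace k w y \<and>
      line_weight g2 k x z + line_weight g1 k z y - \<epsilon> \<le> line_weight f2 k x w + line_weight f1 k w y"
  proof (rule two_line_assemble[OF x z \<open>0 < \<epsilon>\<close> N g f, where D = "\<lambda>u v. - D u v"])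
    fix p l q r z \<epsilon> :: real assume "p \<le> z" "l \<le> z" "z \<le> q" "z \<le> r" "0 < \<epsilon>"
    from switch_transfer(2)[OF f this]
    show "\<exists>w. p \<le> w \<and> l \<le> w \<and> w \<le> q \<and> w \<le> r \<and>
        switch_cost f1 f2 l r w \<le> switch_cost g1 g2 l r z - (- D r q - - D p l) + \<epsilon>"
      by (simp add: g1_def g2_def D_def algebra_simps)
  next
    fix u v assume "v < N"
    from ends[OF this, of u]
    show "f1 v + left_lim f2 N - left_lim f2 u + - D N v - - D u (- 1) =
       g1 v + left_lim g2 N - left_lim g2 u" by simp
  qed auto
qed

section \<open>Disjoint paths as interlacing patterns\<close>

text \<open>
  The entry T i a is the time at which path a moves from line i + 1 to line i; rows n and m - 1
  hold the starting and the final times.  Only the columns a < k matter.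
\<close>

definition patterns :: "nat \<Rightarrow> nat \<Rightarrow> nat \<Rightarrow> (nat \<Rightarrow> real) \<Rightarrow> (nat \<Rightarrow> real) \<Rightarrow> (nat \<Rightarrow> nat \<Rightarrow> real) set" where
  "patterns m n k x y = {T. (\<forall>a<k. T n a = x a \<and> T (m - 1) a = y a) \<and>
     (\<forall>i\<in>{m..n}. interlace k (T i) (T (i - 1)))}"

definition pattern_weight ::
    "(nat \<Rightarrow> real \<Rightarrow> real) \<Rightarrow> nat \<Rightarrow> nat \<Rightarrow> nat \<Rightarrow> (nat \<Rightarrow> nat \<Rightarrow> real) \<Rightarrow> real" where
  "pattern_weight f m n k T = (\<Sum>i=m..n. line_weight (f i) k (T i) (T (i - 1)))"

definition pattern_sup ::
    "(nat \<Rightarrow> real \<Rightarrow> real) \<Rightarrow> nat \<Rightarrow> nat \<Rightarrow> nat \<Rightarrow> (nat \<Rightarrow> real) \<Rightarrow> (nat \<Rightarrow> real) \<Rightarrow> ereal" where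
  "pattern_sup f m n k x y = (SUP T\<in>patterns m n k x y. ereal (pattern_weight f m n k T))"

definition path_set :: "nat \<Rightarrow> nat \<Rightarrow> (nat \<Rightarrow> real) \<Rightarrow> (real \<times> nat) set" where
  "path_set m n t = (\<Union>i\<in>{m..n}. {t i..t (i - 1)} \<times> {i})"

lemma chain_antimono:
  fixes t :: "nat \<Rightarrow> real"
  assumes "\<And>i. i \<in> {m..n} \<Longrightarrow> t i \<le> t (i - 1)" "1 \<le> m" "m - 1 \<le> i" "i \<le> j" "j \<le> n"
  shows "t j \<le> t i"
  using assms(4,5)
proof (induction j rule: dec_induct)
  case (step j)
  then show ?case using assms(1)[of "Suc j"] assms(2,3) by force
qed simp

lemma mem_path_set: "(u, i) \<in> path_set m n t \<longleftrightarrow> i \<in> {m..n} \<and> t i \<le> u \<and> u \<le> t (i - 1)"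
  by (auto simp: path_set_def)

text \<open>
  Being to the left orders the switching times line by line; the segments of two paths on the same
  line are then in weak order, and a finite intersection forbids a proper overlap.
\<close>

lemma disjoint_paths_iff:
  assumes m: "1 \<le> m"
    and t: "\<And>i. i \<in> {m..n} \<Longrightarrow> t i \<le> t (i - 1)" and s: "\<And>i. i \<in> {m..n} \<Longrightarrow> s i \<le> s (i - 1)"
    and ends: "t n \<le> s n" "t (m - 1) \<le> s (m - 1)"
  shows "left_of (path_set m n t) (path_set m n s) \<and>
      essentially_disjoint (path_set m n t) (path_set m n s) \<longleftrightarrow>
    (\<forall>i\<in>{m..n}. t (i - 1) \<le> s i)" (is "?l \<longleftrightarrow> ?r")
proof
  assume ?l
  have le: "t i \<le> s i" if "m - 1 \<le> i" "i \<le> n" for i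
  proof (cases "i = m - 1 \<or> i = n")
    case False
    then have "i \<in> {m..n}" "Suc i \<in> {m..n}" using that by auto
    then have "(t i, Suc i) \<in> path_set m n t" "(s i, i) \<in> path_set m n s"
      using t[of "Suc i"] s[of i] by (auto simp: mem_path_set)
    with \<open>?l\<close> have "Suc i \<le> i \<or> t i \<le> s i" unfolding left_of_def by blast
    then show ?thesis by simp
  qed (use ends in auto)
  show ?r
  proof
    fix i assume i: "i \<in> {m..n}"
    show "t (i - 1) \<le> s i"
    proof (rule ccontr)
      assume "\<not> t (i - 1) \<le> s i"
      then have "s i < t (i - 1)" by simp
      then have "infinite {s i..t (i - 1)}" by (rule infinite_Icc)
      then have "infinite ({s i..t (i - 1)} \<times> {i})"
        by (metis finite_cartesian_productD1 insert_not_empty)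
      moreover have "{s i..t (i - 1)} \<times> {i} \<subseteq> path_set m n t \<inter> path_set m n s"
        using le[of i] le[of "i - 1"] i m by (force simp: mem_path_set)
      ultimately show False
        using \<open>?l\<close> finite_subset unfolding essentially_disjoint_def by blast
    qed
  qed
next
  assume r: ?r
  have "left_of (path_set m n t) (path_set m n s)"
    unfolding left_of_def
  proof safe
    fix u l v j assume *: "(u, l) \<in> path_set m n t" "(v, j) \<in> path_set m n s" "\<not> u \<le> v"
    show "l \<le> j"
    proof (rule ccontr)
      assume "\<not> l \<le> j"
      then have "m - 1 \<le> j" "j \<le> l" "l \<le> n" using * by (auto simp: mem_path_set)
      then have "s l \<le> s j" using chain_antimono[where t = s and m = m and n = n, OF s m] by blast
      moreover have "t (l - 1) \<le> s l" using r * by (auto simp: mem_path_set)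
      ultimately show False using * by (auto simp: mem_path_set)
    qed
  qed
  moreover have "path_set m n t \<inter> path_set m n s \<subseteq> (\<lambda>i. (s i, i)) ` {m..n}"
    using r by (force simp: mem_path_set)
  then have "essentially_disjoint (path_set m n t) (path_set m n s)"
    unfolding essentially_disjoint_def by (rule finite_subset) simp
  ultimately show ?l ..
qed

lemma empty_seg_ring: "{} \<in> seg_ring"
  using seg_ring.Diff[OF seg_ring.seg[of 0 0 0] seg_ring.seg[of 0 0 0]] by simp

lemma df_disjoint_Un:
  "A \<in> seg_ring \<Longrightarrow> B \<in> seg_ring \<Longrightarrow> A \<inter> B = {} \<Longrightarrow> df f (A \<union> B) = df f A + df f B"
  using df_additive[of f] unfolding additive_def by blast

lemma df_empty: "df f {} = 0"
  using df_disjoint_Un[OF empty_seg_ring empty_seg_ring, of f] by simp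

lemma df_left_open:
  assumes "0 \<le> u" "u \<le> v"
  shows "{u<..v} \<times> {i} \<in> seg_ring" "df f ({u<..v} \<times> {i}) = f i v - f i u"
proof -
  have eq: "{u<..v} \<times> {i} = {u..v} \<times> {i} - {u..u} \<times> {i}" by auto
  show mem: "{u<..v} \<times> {i} \<in> seg_ring"
    unfolding eq using assms by (intro seg_ring.intros) auto
  have "{u..v} \<times> {i} = {u..u} \<times> {i} \<union> {u<..v} \<times> {i}" using assms by auto
  moreover have "df f ({u..u} \<times> {i} \<union> {u<..v} \<times> {i}) = df f ({u..u} \<times> {i}) + df f ({u<..v} \<times> {i})"
    by (rule df_disjoint_Un) (use mem assms in \<open>auto intro: seg_ring.seg simp del: atLeastAtMost_singleton\<close>)
  ultimately show "df f ({u<..v} \<times> {i}) = f i v - f i u"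
    using df_seg[of u u f i] df_seg[of u v f i] assms by simp
qed

text \<open>
  Segments are added from left to right.  A new one is either separate from the old ones or starts
  at the last old end point, and then only its left-open part is new.  The bound on the union is
  needed for the induction.
\<close>

lemma df_line_segments:
  assumes "\<And>a. a < k \<Longrightarrow> 0 \<le> x a" "interlace k x y" "line (f i)"
  shows "(\<Union>a<k. {x a..y a}) \<times> {i} \<in> seg_ring \<and>
    df f ((\<Union>a<k. {x a..y a}) \<times> {i}) = line_weight (f i) k x y \<and>
    (\<forall>u \<in> (\<Union>a<k. {x a..y a}). u \<le> prev y k)"
  using assms(1,2)
proof (induction k)
  case 0
  then show ?case
    using line_neg[OF assms(3), of "-1"] by (simp add: empty_seg_ring df_empty line_weight_def)
next
  case (Suc k)
  let ?U = "(\<Union>a<k. {x a..y a}) \<times> {i}"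
  have IH: "?U \<in> seg_ring" "df f ?U = line_weight (f i) k x y" "\<And>u. u \<in> (\<Union>a<k. {x a..y a}) \<Longrightarrow> u \<le> prev y k"
    using Suc.IH Suc.prems by (auto simp: interlace_def)
  have xy: "0 \<le> x k" "x k \<le> y k" "prev y k \<le> x k"
    using Suc.prems Suc.prems(1)[of 0] by (auto simp: interlace_def prev_def split: nat.splits)
  have un: "(\<Union>a<Suc k. {x a..y a}) \<times> {i} = ?U \<union> {x k..y k} \<times> {i}"
    by (auto simp: less_Suc_eq)
  have weight: "line_weight (f i) (Suc k) x y =
      line_weight (f i) k x y + f i (y k) - f i (prev y k) - gap (f i) (prev y k) (x k)"
    by (simp add: line_weight_def)
  have step: "?U \<union> {x k..y k} \<times> {i} \<in> seg_ring \<and>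
      df f (?U \<union> {x k..y k} \<times> {i}) = line_weight (f i) (Suc k) x y"
  proof (cases "prev y k < x k")
    case True
    have "?U \<inter> {x k..y k} \<times> {i} = {}"
    proof (rule equals0I)
      fix p assume p: "p \<in> ?U \<inter> {x k..y k} \<times> {i}"
      then have "fst p \<in> (\<Union>a<k. {x a..y a})" by (simp only: Int_iff mem_Times_iff)
      then have "fst p \<le> prev y k" by (rule IH(3))
      then show False using p True by auto
    qed
    moreover have "{x k..y k} \<times> {i} \<in> seg_ring" using xy by (intro seg_ring.seg)
    moreover have "df f ({x k..y k} \<times> {i}) = f i (y k) - left_lim (f i) (x k)"
      using df_seg[of "x k" "y k" f i] xy by simp
    ultimately show ?thesis
      using df_disjoint_Un[OF IH(1)] seg_ring.Un[OF IH(1)] IH(2) True by (simp add: weight gap_def)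
  next
    case False
    then have eq: "prev y k = x k" using xy by simp
    then obtain b where b: "k = Suc b" using xy(1) by (cases k) auto
    then have "x b \<le> y b" using Suc.prems(2) by (simp add: interlace_def)
    then have "x k \<in> {x b..y b}" using eq b by simp
    then have mem: "(x k, i) \<in> ?U" using b by blast
    have "{x k..y k} \<times> {i} = insert (x k, i) ({x k<..y k} \<times> {i})" using xy(2) by auto
    then have un': "?U \<union> {x k..y k} \<times> {i} = ?U \<union> {x k<..y k} \<times> {i}"
      by (simp only: Un_insert_right insert_absorb[OF UnI1[OF mem]])
    have "?U \<inter> {x k<..y k} \<times> {i} = {}"
    proof (rule equals0I)
      fix p assume p: "p \<in> ?U \<inter> {x k<..y k} \<times> {i}"
      then have "fst p \<in> (\<Union>a<k. {x a..y a})" by (simp only: Int_iff mem_Times_iff)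
      then have "fst p \<le> prev y k" by (rule IH(3))
      then show False using p eq by auto
    qed
    then show ?thesis
      unfolding un'
      using df_disjoint_Un[OF IH(1) df_left_open(1)[OF xy(1,2)]] seg_ring.Un[OF IH(1) df_left_open(1)[OF xy(1,2)]]
        IH(2) eq df_left_open(2)[OF xy(1,2)] by (simp add: weight gap_def)
  qed
  have bound: "u \<le> prev y (Suc k)" if u: "u \<in> (\<Union>a<Suc k. {x a..y a})" for u
  proof -
    obtain a where a: "a < Suc k" "u \<in> {x a..y a}" using u by blast
    show ?thesis
    proof (cases "a = k")
      case False
      then have "u \<in> (\<Union>a<k. {x a..y a})" using a by (intro UN_I[of a]) auto
      then have "u \<le> prev y k" by (rule IH(3))
      then show ?thesis using xy by simp
    qed (use a in simp)
  qed
  show ?case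
    unfolding un by (rule conjI[OF step[THEN conjunct1] conjI[OF step[THEN conjunct2] ballI[OF bound]]])
qed

lemma df_lines:
  assumes "\<And>i. i \<in> I \<Longrightarrow> U i \<times> {i} \<in> seg_ring" "finite I"
  shows "(\<Union>i\<in>I. U i \<times> {i}) \<in> seg_ring \<and> df f (\<Union>i\<in>I. U i \<times> {i}) = (\<Sum>i\<in>I. df f (U i \<times> {i}))"
  using assms(2,1)
proof (induction I rule: finite_induct)
  case (insert j I)
  have "(U j \<times> {j}) \<inter> (\<Union>i\<in>I. U i \<times> {i}) = {}" using insert.hyps by auto
  then show ?case
    using insert df_disjoint_Un[of "U j \<times> {j}" "\<Union>i\<in>I. U i \<times> {i}" f] by (auto intro: seg_ring.Un)
qed (simp add: empty_seg_ring df_empty)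

lemma pattern_mono:
  assumes "T \<in> patterns m n k x y" "1 \<le> m" "a < k" "m - 1 \<le> i" "i \<le> j" "j \<le> n"
  shows "T j a \<le> T i a"
  by (rule chain_antimono[where t = "\<lambda>i. T i a" and m = m and n = n]) (use assms in \<open>auto simp: patterns_def interlace_def\<close>)

lemma pattern_nonneg:
  assumes "T \<in> patterns m n k x y" "1 \<le> m" "\<And>a. a < k \<Longrightarrow> 0 \<le> x a" "a < k" "m - 1 \<le> i" "i \<le> n"
  shows "0 \<le> T i a"
proof -
  have "T n a = x a" using assms(1,4) by (simp add: patterns_def)
  then show ?thesis
    using pattern_mono[OF assms(1,2,4,5,6) order_refl] assms(3)[OF assms(4)] by simp
qed

lemma pattern_df:
  assumes T: "T \<in> patterns m n k x y" and m: "1 \<le> m" and x: "\<And>a. a < k \<Longrightarrow> 0 \<le> x a"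
    and f: "\<And>i. i \<in> {m..n} \<Longrightarrow> line (f i)"
  shows "df f (\<Union>a<k. path_set m n (\<lambda>i. T i a)) = pattern_weight f m n k T"
proof -
  let ?U = "\<lambda>i. \<Union>a<k. {T i a..T (i - 1) a}"
  have "?U i \<times> {i} \<in> seg_ring \<and> df f (?U i \<times> {i}) = line_weight (f i) k (T i) (T (i - 1))"
    if "i \<in> {m..n}" for i
    using df_line_segments[of k "T i" "T (i - 1)" f i] pattern_nonneg[OF T m x, of _ i] f[OF that] T that
    by (auto simp: patterns_def)
  then have "df f (\<Union>i\<in>{m..n}. ?U i \<times> {i}) = pattern_weight f m n k T"
    using df_lines[of "{m..n}" ?U f] by (simp add: pattern_weight_def)
  moreover have "(\<Union>a<k. path_set m n (\<lambda>i. T i a)) = (\<Union>i\<in>{m..n}. ?U i \<times> {i})"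
    by (auto simp: path_set_def)
  ultimately show ?thesis by simp
qed

lemma pattern_separated:
  assumes T: "T \<in> patterns m n k x y" and m: "1 \<le> m" and "a < b" "b < k" and i: "i \<in> {m..n}"
  shows "T (i - 1) a \<le> T i b"
  using assms(3,4)
proof (induction b)
  case (Suc b)
  have "T (i - 1) b \<le> T i (Suc b)" using T i Suc.prems by (auto simp: patterns_def interlace_def)
  moreover have "T i b \<le> T (i - 1) b" using T i Suc.prems by (auto simp: patterns_def interlace_def)
  ultimately show ?case using Suc by (cases "a = b") auto
qed simp

lemma disjoint_tuples_patterns:
  assumes m: "1 \<le> m" "m \<le> n" and k: "length xs = k" "length ys = k"
    and sorted: "sorted xs" "sorted ys" and x: "set xs \<subseteq> {0..}"
  shows "disjoint_tuples (map (\<lambda>x. (x, n)) xs) (map (\<lambda>y. (y, m)) ys) =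
    (\<lambda>T. map (\<lambda>a. path_set m n (\<lambda>i. T i a)) [0..<k]) ` patterns m n k (nth xs) (nth ys)"
    (is "?D = ?F ` ?P")
proof (intro equalityI subsetI)
  fix \<pi>s assume "\<pi>s \<in> ?D"
  then have len: "length \<pi>s = k"
    and path: "\<And>a. a < k \<Longrightarrow> is_path (xs ! a, n) (ys ! a, m) (\<pi>s ! a)"
    and disj: "\<And>a b. a < b \<Longrightarrow> b < k \<Longrightarrow> left_of (\<pi>s ! a) (\<pi>s ! b) \<and> essentially_disjoint (\<pi>s ! a) (\<pi>s ! b)"
    using k by (auto simp: disjoint_tuples_def)
  have "\<exists>t. t n = xs ! a \<and> t (m - 1) = ys ! a \<and> (\<forall>i\<in>{m..n}. t i \<le> t (i - 1)) \<and> \<pi>s ! a = path_set m n t"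
    if "a < k" for a
    using path[OF that] by (auto simp: is_path_def path_set_def)
  then obtain t where t: "\<And>a. a < k \<Longrightarrow> t a n = xs ! a \<and> t a (m - 1) = ys ! a \<and>
      (\<forall>i\<in>{m..n}. t a i \<le> t a (i - 1)) \<and> \<pi>s ! a = path_set m n (t a)"
    by metis
  have "t a (i - 1) \<le> t (Suc a) i" if a: "Suc a < k" and i: "i \<in> {m..n}" for a i
  proof -
    have "t a n \<le> t (Suc a) n" "t a (m - 1) \<le> t (Suc a) (m - 1)"
      using t[of a] t[of "Suc a"] a sorted k sorted_nth_mono[of xs a "Suc a"] sorted_nth_mono[of ys a "Suc a"]
      by auto
    from disjoint_paths_iff[OF m(1) _ _ this]
    show ?thesis using t[of a] t[of "Suc a"] disj[of a "Suc a"] a i by auto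
  qed
  then have "(\<lambda>i a. t a i) \<in> ?P" using t by (auto simp: patterns_def interlace_def)
  moreover have "\<pi>s = ?F (\<lambda>i a. t a i)" by (rule nth_equalityI) (use t len in auto)
  ultimately show "\<pi>s \<in> ?F ` ?P" by (intro image_eqI[of _ _ "\<lambda>i a. t a i"]) simp_all
next
  fix \<pi>s assume "\<pi>s \<in> ?F ` ?P"
  then obtain T where T: "T \<in> ?P" and \<pi>s: "\<pi>s = ?F T" by blast
  have mono: "T i a \<le> T (i - 1) a" if "a < k" "i \<in> {m..n}" for i a
    using T that by (auto simp: patterns_def interlace_def)
  have ends: "T n a = xs ! a" "T (m - 1) a = ys ! a" if "a < k" for a
    using T that by (auto simp: patterns_def)
  have "is_path (xs ! a, n) (ys ! a, m) (path_set m n (\<lambda>i. T i a))" if "a < k" for a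
  proof -
    have "xs ! a \<in> set xs" using that k(1) by simp
    then have "0 \<le> xs ! a" using x by auto
    moreover have "xs ! a \<le> ys ! a"
      using pattern_mono[OF T m(1) that, of "m - 1" n] ends[OF that] m by simp
    moreover have "\<exists>t. t n = xs ! a \<and> t (m - 1) = ys ! a \<and> (\<forall>i\<in>{m..n}. t i \<le> t (i - 1)) \<and>
        path_set m n (\<lambda>i. T i a) = (\<Union>i\<in>{m..n}. {t i..t (i - 1)} \<times> {i})"
      using ends[OF that] mono[OF that] by (intro exI[of _ "\<lambda>i. T i a"]) (simp add: path_set_def)
    ultimately show ?thesis using m by (simp add: is_path_def)
  qed
  moreover have "left_of (path_set m n (\<lambda>i. T i a)) (path_set m n (\<lambda>i. T i b)) \<and>
      essentially_disjoint (path_set m n (\<lambda>i. T i a)) (path_set m n (\<lambda>i. T i b))"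
    if "a < b" "b < k" for a b
  proof (subst disjoint_paths_iff[OF m(1)])
    show "T n a \<le> T n b" "T (m - 1) a \<le> T (m - 1) b"
      using ends[of a] ends[of b] that sorted k sorted_nth_mono[of xs a b] sorted_nth_mono[of ys a b] by auto
    show "\<forall>i\<in>{m..n}. T (i - 1) a \<le> T i b"
      using pattern_separated[OF T m(1) that] by blast
  qed (use mono that in auto)
  ultimately show "\<pi>s \<in> ?D" using k by (auto simp: disjoint_tuples_def \<pi>s)
qed

text \<open>
  This replaces sets of paths by arrays of reals, whose rows can be varied one at a time.
\<close>

theorem last_passage_patterns:
  assumes "1 \<le> m" "m \<le> n" "length xs = k" "length ys = k"
    and "sorted xs" "sorted ys" "set xs \<subseteq> {0..}"
    and f: "\<And>i. i \<in> {m..n} \<Longrightarrow> line (f i)"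
  shows "last_passage f (map (\<lambda>x. (x, n)) xs) (map (\<lambda>y. (y, m)) ys) =
    pattern_sup f m n k (nth xs) (nth ys)"
proof -
  have x: "0 \<le> xs ! a" if "a < k" for a
    using subsetD[OF assms(7) nth_mem[of a xs]] assms(3) that by simp
  have "df f (\<Union>(set (map (\<lambda>a. path_set m n (\<lambda>i. T i a)) [0..<k]))) = pattern_weight f m n k T"
    if "T \<in> patterns m n k (nth xs) (nth ys)" for T
    using pattern_df[OF that assms(1) x f] by (simp add: atLeast0LessThan)
  then show ?thesis
    unfolding last_passage_def pattern_sup_def disjoint_tuples_patterns[OF assms(1-7)] image_image
    by (intro SUP_cong) auto
qed

section \<open>The two-line transform on a stack of lines\<close>

lemma line_weight_single: "line g \<Longrightarrow> 0 \<le> x 0 \<Longrightarrow> line_weight g (Suc 0) x y = g (y 0) - left_lim g (x 0)"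
  using line_neg[of g "-1"] by (simp add: line_weight_def gap_def)

lemma last_passage_two_lines:
  assumes f: "line f1" "line f2" and "0 \<le> x"
  shows "last_passage ((\<lambda>_ _. 0)(1 := f1, 2 := f2)) [(0, 2)] [(x, 1)] = ereal (f1 x + run_max f1 f2 x)"
proof -
  let ?h = "(\<lambda>_ _. 0)(1 := f1, 2 := f2)"
  let ?M = "run_max f1 f2"
  have I: "{1..2::nat} = {1, 2}" by auto
  have h: "line (?h i)" if "i \<in> {1..2}" for i :: nat
  proof -
    have "i = 1 \<or> i = 2" using that by auto
    then show ?thesis using f by (elim disjE) simp_all
  qed
  have weight: "pattern_weight ?h 1 2 1 T = f1 x + (f2 (T 1 0) - left_lim f1 (T 1 0))"
    if "T \<in> patterns 1 2 1 (nth [0]) (nth [x])" for T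
  proof -
    have "T 2 0 = 0" "T 0 0 = x" "0 \<le> T 1 0"
      using that pattern_nonneg[OF that, of 0 1] by (auto simp: patterns_def)
    then show ?thesis
      unfolding pattern_weight_def I using f by (simp add: line_weight_single left_lim_def[of _ 0])
  qed
  have "last_passage ?h [(0, 2)] [(x, 1)] = pattern_sup ?h 1 2 1 (nth [0]) (nth [x])"
    using last_passage_patterns[of 1 2 "[0]" 1 "[x]" ?h] h \<open>0 \<le> x\<close> by simp
  also have "\<dots> = ereal (f1 x + ?M x)"
  proof (rule antisym)
    show "pattern_sup ?h 1 2 1 (nth [0]) (nth [x]) \<le> ereal (f1 x + ?M x)"
      unfolding pattern_sup_def
    proof (rule SUP_least)
      fix T assume T: "T \<in> patterns 1 2 1 (nth [0]) (nth [x])"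
      then have "T 1 0 \<le> x" by (force simp: patterns_def interlace_def)
      then show "ereal (pattern_weight ?h 1 2 1 T) \<le> ereal (f1 x + ?M x)"
        unfolding weight[OF T] using run_max_upper[OF f] by simp
    qed
    show "ereal (f1 x + ?M x) \<le> pattern_sup ?h 1 2 1 (nth [0]) (nth [x])"
    proof (rule ereal_le_epsilon2)
      fix e :: real assume "0 < e"
      then obtain u where u: "u \<le> x" "?M x - e < f2 u - left_lim f1 u"
        using run_max_less[OF f, of "?M x - e" x] by auto
      define z where "z = max u 0"
      have "f2 u - left_lim f1 u \<le> f2 z - left_lim f1 z"
        using line_neg[OF f(2), of u] line_jump[OF f(2), of 0]
        by (cases u "0::real" rule: linorder_cases) (auto simp: z_def left_lim_def)
      then have z: "0 \<le> z" "z \<le> x" "?M x - e < f2 z - left_lim f1 z"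
        using u \<open>0 \<le> x\<close> by (auto simp: z_def)
      define T where "T i a = (if i = 2 then 0 else if i = 1 then z else x)" for i a :: nat
      have T: "T \<in> patterns 1 2 1 (nth [0]) (nth [x])"
        using z by (auto simp: patterns_def interlace_def T_def I)
      have "ereal (f1 x + ?M x) \<le> ereal (pattern_weight ?h 1 2 1 T) + ereal e"
        unfolding weight[OF T] using z(3) by (simp add: T_def)
      also have "\<dots> \<le> pattern_sup ?h 1 2 1 (nth [0]) (nth [x]) + ereal e"
        unfolding pattern_sup_def by (intro add_right_mono SUP_upper T)
      finally show "ereal (f1 x + ?M x) \<le> pattern_sup ?h 1 2 1 (nth [0]) (nth [x]) + ereal e" .
    qed
  qed
  finally show ?thesis .
qed

lemma pitman_at_run_max:
  assumes "line (f i)" "line (f (Suc i))"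
  shows "pitman_at i f = f(i := \<lambda>x. f i x + run_max (f i) (f (Suc i)) x,
    Suc i := \<lambda>x. f (Suc i) x - run_max (f i) (f (Suc i)) x)"
proof -
  have "(if 0 \<le> x then real_of_ereal (last_passage ((\<lambda>_ _. 0)(1 := f i, 2 := f (Suc i))) [(0, 2)] [(x, 1)]) else 0) =
    f i x + run_max (f i) (f (Suc i)) x" for x
    using last_passage_two_lines[OF assms, of x] line_neg[OF assms(1), of x] run_max_neg[OF assms, of x] by auto
  then show ?thesis unfolding pitman_at_def pitman_def Let_def by (simp add: fun_eq_iff)
qed

lemma pitman_at_other: "j \<noteq> i \<Longrightarrow> j \<noteq> Suc i \<Longrightarrow> pitman_at i f j = f j"
  by (simp add: pitman_at_def Let_def)

lemma pitman_at_cadlag_space: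
  assumes "f \<in> cadlag_space n" "1 \<le> i" "i < n"
  shows "pitman_at i f \<in> cadlag_space n"
proof -
  have f: "line (f i)" "line (f (Suc i))" using assms by (auto simp: cadlag_space_iff)
  show ?thesis
    using assms pitman_top_line[OF f] pitman_bottom_line[OF f]
    unfolding pitman_at_run_max[of f, OF f] cadlag_space_iff by auto
qed

text \<open>
  Row i of a pattern occurs only in the weights of lines i and i + 1.  Replacing it with its
  neighbours held fixed is thus a two-line problem.
\<close>

lemma pattern_replace_level:
  assumes T: "T \<in> patterns m n k x y" and m: "1 \<le> m" "m \<le> i" "i < n" and x: "\<And>a. a < k \<Longrightarrow> 0 \<le> x a"
    and h: "\<And>j. j \<noteq> i \<Longrightarrow> j \<noteq> Suc i \<Longrightarrow> h j = f j"
    and transfer: "\<And>x y z. (\<And>a. a < k \<Longrightarrow> 0 \<le> x a) \<Longrightarrow> interlace k x z \<Longrightarrow> interlace k z y \<Longrightarrow>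
      \<exists>w. interlace k x w \<and> interlace k w y \<and>
        line_weight (f (Suc i)) k x z + line_weight (f i) k z y - \<epsilon> \<le>
        line_weight (h (Suc i)) k x w + line_weight (h i) k w y"
  shows "\<exists>T'\<in>patterns m n k x y. pattern_weight f m n k T - \<epsilon> \<le> pattern_weight h m n k T'"
proof -
  have inter: "interlace k (T j) (T (j - 1))" if "j \<in> {m..n}" for j
    using T that by (simp add: patterns_def)
  obtain w where w: "interlace k (T (Suc i)) w" "interlace k w (T (i - 1))"
    and le: "line_weight (f (Suc i)) k (T (Suc i)) (T i) + line_weight (f i) k (T i) (T (i - 1)) - \<epsilon> \<le>
      line_weight (h (Suc i)) k (T (Suc i)) w + line_weight (h i) k w (T (i - 1))"
    using transfer[of "T (Suc i)" "T i" "T (i - 1)"] inter[of i] inter[of "Suc i"] m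
      pattern_nonneg[OF T m(1) x, of _ "Suc i"] by auto
  define T' where "T' = T(i := w)"
  have "T' \<in> patterns m n k x y"
    unfolding patterns_def
  proof (safe)
    fix j assume j: "j \<in> {m..n}"
    then consider "j = i" | "j = Suc i" | "j \<noteq> i" "j - 1 \<noteq> i" using m by fastforce
    then show "interlace k (T' j) (T' (j - 1))"
      by cases (use w inter[OF j] m in \<open>auto simp: T'_def\<close>)
  qed (use T m in \<open>auto simp: T'_def patterns_def\<close>)
  moreover have split: "pattern_weight g m n k S = line_weight (g (Suc i)) k (S (Suc i)) (S i) +
      line_weight (g i) k (S i) (S (i - 1)) + (\<Sum>j\<in>{m..n} - {i, Suc i}. line_weight (g j) k (S j) (S (j - 1)))" for g S
    unfolding pattern_weight_def
    using m by (subst sum.subset_diff[of "{i, Suc i}"]) auto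
  have "(\<Sum>j\<in>{m..n} - {i, Suc i}. line_weight (h j) k (T' j) (T' (j - 1))) =
      (\<Sum>j\<in>{m..n} - {i, Suc i}. line_weight (f j) k (T j) (T (j - 1)))"
  proof (rule sum.cong[OF refl])
    fix j assume "j \<in> {m..n} - {i, Suc i}"
    then have "j \<noteq> i" "j \<noteq> Suc i" "j - 1 \<noteq> i" using m by auto
    then show "line_weight (h j) k (T' j) (T' (j - 1)) = line_weight (f j) k (T j) (T (j - 1))"
      by (simp add: T'_def h)
  qed
  then have "pattern_weight f m n k T - \<epsilon> \<le> pattern_weight h m n k T'"
    unfolding split using le m by (auto simp: T'_def)
  ultimately show ?thesis by blast
qed

lemma pattern_sup_le:
  assumes "\<And>T \<epsilon>. T \<in> patterns m n k x y \<Longrightarrow> 0 < \<epsilon> \<Longrightarrow>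
    \<exists>T'\<in>patterns m n k x y. pattern_weight f m n k T - \<epsilon> \<le> pattern_weight h m n k T'"
  shows "pattern_sup f m n k x y \<le> pattern_sup h m n k x y"
  unfolding pattern_sup_def[of f]
proof (rule SUP_least, rule ereal_le_epsilon2)
  fix T and e :: real assume "T \<in> patterns m n k x y" "0 < e"
  then obtain T' where T': "T' \<in> patterns m n k x y"
    and "pattern_weight f m n k T - e \<le> pattern_weight h m n k T'" using assms by blast
  then have "ereal (pattern_weight f m n k T) \<le> ereal (pattern_weight h m n k T') + ereal e" by simp
  also have "\<dots> \<le> pattern_sup h m n k x y + ereal e"
    unfolding pattern_sup_def by (intro add_right_mono SUP_upper T')
  finally show "ereal (pattern_weight f m n k T) \<le> pattern_sup h m n k x y + ereal e" .
qed

theorem pattern_sup_pitman_at: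
  assumes f: "f \<in> cadlag_space n" and m: "1 \<le> m" "m \<le> i" "i < n" and x: "\<And>a. a < k \<Longrightarrow> 0 \<le> x a"
  shows "pattern_sup (pitman_at i f) m n k x y = pattern_sup f m n k x y"
proof -
  have l: "line (f i)" "line (f (Suc i))" using f m by (auto simp: cadlag_space_iff)
  note tr = two_line_transfer[OF l]
  have eq: "pitman_at i f i = (\<lambda>x. f i x + run_max (f i) (f (Suc i)) x)"
    "pitman_at i f (Suc i) = (\<lambda>x. f (Suc i) x - run_max (f i) (f (Suc i)) x)"
    by (simp_all add: pitman_at_run_max[of f, OF l])
  show ?thesis
  proof (rule antisym; rule pattern_sup_le)
    fix T and \<epsilon> :: real assume T: "T \<in> patterns m n k x y" and \<epsilon>: "0 < \<epsilon>"
    show "\<exists>T'\<in>patterns m n k x y. pattern_weight (pitman_at i f) m n k T - \<epsilon> \<le> pattern_weight f m n k T'"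
      by (rule pattern_replace_level[OF T m x]; (unfold eq)?)
         (auto simp: pitman_at_other intro: tr(2)[OF _ _ _ \<epsilon>])
    show "\<exists>T'\<in>patterns m n k x y. pattern_weight f m n k T - \<epsilon> \<le> pattern_weight (pitman_at i f) m n k T'"
      by (rule pattern_replace_level[OF T m x]; (unfold eq)?)
         (auto simp: pitman_at_other intro: tr(1)[OF _ _ _ \<epsilon>])
  qed
qed

section \<open>Sweeps of two-line transforms\<close>

lemma foldr_comp_invariant:
  assumes "P f" "\<forall>h\<in>set hs. \<forall>g. P g \<longrightarrow> P (h g)"
  shows "P (foldr (\<circ>) hs id f)"
  using assms(2) by (induction hs) (simp_all add: assms(1))

lemma foldr_comp_append: "foldr (\<circ>) (hs @ hs') id f = foldr (\<circ>) hs id (foldr (\<circ>) hs' id f)"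
  by (induction hs) simp_all

definition sweeps :: "nat \<Rightarrow> nat list \<Rightarrow> (nat \<Rightarrow> real \<Rightarrow> real) \<Rightarrow> nat \<Rightarrow> real \<Rightarrow> real" where
  "sweeps n ms = foldr (\<circ>) (map (pitman_sweep n) (rev ms)) id"

lemma pitman_sweep_invariant:
  assumes "P f" "\<And>i g. m \<le> i \<Longrightarrow> i < n \<Longrightarrow> P g \<Longrightarrow> P (pitman_at i g)"
  shows "P (pitman_sweep n m f)"
proof -
  have "\<forall>h\<in>set (map pitman_at [m..<n]). \<forall>g. P g \<longrightarrow> P (h g)"
    using assms(2) by simp
  with assms(1) show ?thesis unfolding pitman_sweep_def by (rule foldr_comp_invariant)
qed

lemma sweeps_invariant:
  assumes "P f" "\<And>i g. m \<le> i \<Longrightarrow> i < n \<Longrightarrow> P g \<Longrightarrow> P (pitman_at i g)" "\<And>j. j \<in> set ms \<Longrightarrow> m \<le> j"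
  shows "P (sweeps n ms f)"
proof -
  have "P (pitman_sweep n j g)" if "j \<in> set ms" "P g" for j g
  proof (rule pitman_sweep_invariant[of P, OF that(2)])
    fix i g' assume "j \<le> i" "i < n" "P g'"
    then show "P (pitman_at i g')" using assms(2)[of i g'] assms(3)[OF that(1)] by simp
  qed
  then have "\<forall>h\<in>set (map (pitman_sweep n) (rev ms)). \<forall>g. P g \<longrightarrow> P (h g)" by simp
  with assms(1) show ?thesis unfolding sweeps_def by (rule foldr_comp_invariant)
qed

lemma sweeps_append: "sweeps n (ms @ ms') f = sweeps n ms' (sweeps n ms f)"
  unfolding sweeps_def rev_append map_append by (rule foldr_comp_append)

lemma sweeps_single: "sweeps n [m] f = pitman_sweep n m f"
  by (simp add: sweeps_def)

lemma iter_pitman_sweeps: "iter_pitman n = sweeps n [1..<n]"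
  by (simp add: iter_pitman_def sweeps_def)

lemma pitman_sweep_rec: "m < n \<Longrightarrow> pitman_sweep n m f = pitman_at m (pitman_sweep n (Suc m) f)"
  by (simp add: pitman_sweep_def upt_conv_Cons)

lemma sweeps_cadlag_space:
  assumes "f \<in> cadlag_space n" "\<And>j. j \<in> set ms \<Longrightarrow> 1 \<le> j"
  shows "sweeps n ms f \<in> cadlag_space n"
  by (rule sweeps_invariant[where m = 1]) (use assms pitman_at_cadlag_space in auto)

lemma iter_pitman_cadlag_space: "f \<in> cadlag_space n \<Longrightarrow> iter_pitman n f \<in> cadlag_space n"
  unfolding iter_pitman_sweeps by (rule sweeps_cadlag_space) auto

lemma pattern_sup_sweeps:
  assumes f: "f \<in> cadlag_space n" and m: "1 \<le> m" "\<And>j. j \<in> set ms \<Longrightarrow> m \<le> j"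
    and x: "\<And>a. a < k \<Longrightarrow> 0 \<le> x a"
  shows "pattern_sup (sweeps n ms f) m n k x y = pattern_sup f m n k x y"
proof -
  let ?P = "\<lambda>g. g \<in> cadlag_space n \<and> pattern_sup g m n k x y = pattern_sup f m n k x y"
  have "?P (sweeps n ms f)"
  proof (rule sweeps_invariant[where m = m and P = ?P])
    fix i g assume "m \<le> i" "i < n" "?P g"
    then show "?P (pitman_at i g)"
      using pattern_sup_pitman_at[of g n m i k x y] m(1) x pitman_at_cadlag_space[of g n i] by simp
  qed (use f m in auto)
  then show ?thesis by simp
qed

theorem iter_pitman_isometric:
  assumes f: "f \<in> cadlag_space n"
  shows "isometric n (iter_pitman n f) f"
proof (cases "n = 0")
  case True
  then show ?thesis by (simp add: isometric_def iter_pitman_def)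
next
  case False
  then have n: "1 \<le> n" by simp
  let ?g = "iter_pitman n f"
  have lines: "line (f i)" "line (?g i)" if "i \<in> {1..n}" for i
    using that f iter_pitman_cadlag_space[OF f] by (auto simp: cadlag_space_iff)
  show ?thesis
    unfolding isometric_def
  proof (intro allI impI)
    fix xs ys :: "real list"
    assume *: "length xs = length ys" "sorted xs" "sorted ys" "set xs \<subseteq> {0..}" "set ys \<subseteq> {0..}"
    have x: "0 \<le> xs ! a" if "a < length ys" for a
      using subsetD[OF *(4) nth_mem[of a xs]] that *(1) by simp
    have "pattern_sup ?g 1 n (length ys) (nth xs) (nth ys) = pattern_sup f 1 n (length ys) (nth xs) (nth ys)"
      unfolding iter_pitman_sweeps by (rule pattern_sup_sweeps[OF f]) (use x in auto)
    then show "last_passage ?g (map (\<lambda>x. (x, n)) xs) (map (\<lambda>y. (y, 1)) ys) =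
        last_passage f (map (\<lambda>x. (x, n)) xs) (map (\<lambda>y. (y, 1)) ys)"
      using last_passage_patterns[OF order_refl n *(1) refl *(2-4) lines(1)]
        last_passage_patterns[OF order_refl n *(1) refl *(2-4) lines(2)] by simp
  qed
qed

section \<open>The output is ordered\<close>

lemma pattern_weight_first:
  assumes "1 \<le> m" "m < n"
  shows "pattern_weight f m n k T = line_weight (f m) k (T m) (T (m - 1)) + pattern_weight f (Suc m) n k T"
  using assms by (simp add: pattern_weight_def sum.atLeast_Suc_atMost)

text \<open>
  The sweep works upwards from line n: line m becomes the best way of following the already
  accumulated line m + 1 up to some time z and the original line m from then on.
\<close>

lemma pitman_sweep_top:
  assumes f: "f \<in> cadlag_space n" and "m \<le> n" "1 \<le> m" and "T \<in> patterns m n 1 (\<lambda>_. 0) y"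
  shows "pattern_weight f m n 1 T \<le> pitman_sweep n m f m (y 0)"
  using assms(2-4)
proof (induction m arbitrary: y rule: inc_induct)
  case base
  then have "line (f n)" "T n 0 = 0" "T (n - 1) 0 = y 0" using f by (auto simp: cadlag_space_iff patterns_def)
  then show ?case by (simp add: pattern_weight_def pitman_sweep_def line_weight_single left_lim_def)
next
  case (step m)
  define h where "h = pitman_sweep n (Suc m) f"
  have "h \<in> cadlag_space n"
    unfolding h_def
    by (rule pitman_sweep_invariant[where P = "\<lambda>g. g \<in> cadlag_space n"]) (use f pitman_at_cadlag_space in auto)
  then have lines: "line (h m)" "line (h (Suc m))" using step by (auto simp: cadlag_space_iff)
  have hm: "h m = f m"
    unfolding h_def
    by (rule pitman_sweep_invariant[where P = "\<lambda>g. g m = f m"]) (auto simp: pitman_at_other)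
  define z where "z = T m 0"
  have T: "T (m - 1) 0 = y 0" "z \<le> y 0" "0 \<le> z"
    using step.prems step.hyps pattern_nonneg[OF step.prems(2,1), of 0 m]
      pattern_mono[OF step.prems(2,1), of 0 "m - 1" m]
    by (auto simp: patterns_def z_def)
  have "T \<in> patterns (Suc m) n 1 (\<lambda>_. 0) (T m)" using step.prems by (auto simp: patterns_def)
  then have "pattern_weight f (Suc m) n 1 T \<le> h (Suc m) z"
    using step.IH step.prems by (simp add: h_def z_def)
  moreover have "line_weight (f m) 1 (T m) (T (m - 1)) = h m (y 0) - left_lim (h m) z"
    using T lines(1) by (simp add: line_weight_single hm z_def)
  moreover have "h (Suc m) z - left_lim (h m) z \<le> run_max (h m) (h (Suc m)) (y 0)"
    using run_max_upper[OF lines T(2)] .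
  moreover have "pitman_sweep n m f m (y 0) = h m (y 0) + run_max (h m) (h (Suc m)) (y 0)"
    using step.hyps pitman_at_run_max[of h, OF lines] by (simp add: pitman_sweep_rec h_def)
  ultimately show ?case
    using step by (simp add: pattern_weight_first)
qed

text \<open>
  The path at 0 on the lines below m + 1, on line m + 1 until s, and at s on line m has weight at
  least \<open>h (m + 1) s + h m s - h m (s-)\<close> in the output h.  By isometry on the block of lines
  m, ..., n, its weight is at most the single-path value of the stack just before the sweep
  \<open>\<tau>\<^sub>m\<close>, hence at most what that sweep puts into line m, which is \<open>h m s\<close>.
\<close>

lemma iter_pitman_adjacent:
  assumes f: "f \<in> cadlag_space n" and m: "1 \<le> m" "m < n" and s: "0 \<le> s"
  shows "iter_pitman n f (Suc m) s \<le> left_lim (iter_pitman n f m) s"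
proof -
  define g where "g = sweeps n [1..<m] f"
  define h where "h = iter_pitman n f"
  have g: "g \<in> cadlag_space n" unfolding g_def by (rule sweeps_cadlag_space[OF f]) auto
  have h: "h \<in> cadlag_space n" using iter_pitman_cadlag_space[OF f] by (simp add: h_def)
  have "[1..<n] = [1..<m] @ [m..<n]" using m upt_add_eq_append[of 1 m "n - m"] by simp
  then have hg: "h = sweeps n [m..<n] g"
    by (simp add: h_def iter_pitman_sweeps sweeps_append g_def)
  also have "\<dots> = sweeps n [Suc m..<n] (pitman_sweep n m g)"
    using m sweeps_append[of n "[m]" "[Suc m..<n]" g] by (simp add: upt_conv_Cons sweeps_single)
  finally have hm: "h m = pitman_sweep n m g m"
    using sweeps_invariant[where P = "\<lambda>f. f m = pitman_sweep n m g m" and m = "Suc m" and n = n and ms = "[Suc m..<n]"]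
    by (simp add: pitman_at_other)
  define T where "T i a = (if i \<le> m then s else 0)" for i a :: nat
  have T: "T \<in> patterns m n 1 (\<lambda>_. 0) (\<lambda>_. s)"
    using m s by (auto simp: patterns_def interlace_def T_def)
  have lines: "line (h i)" if "i \<in> {1..n}" for i using h that by (simp add: cadlag_space_iff)
  have w: "line_weight (h i) 1 (T i) (T (i - 1)) = h i (T (i - 1) 0) - left_lim (h i) (T i 0)" if "i \<in> {1..n}" for i
    using line_weight_single[OF lines[OF that]] s by (simp add: T_def)
  have "0 \<le> (\<Sum>i=Suc (Suc m)..n. line_weight (h i) 1 (T i) (T (i - 1)))"
  proof (rule sum_nonneg)
    fix i assume i: "i \<in> {Suc (Suc m)..n}"
    then have "line_weight (h i) 1 (T i) (T (i - 1)) = h i 0 - left_lim (h i) 0"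
      using m by (subst w) (auto simp: T_def)
    then show "0 \<le> line_weight (h i) 1 (T i) (T (i - 1))"
      using line_jump[OF lines, of i 0] i m by simp
  qed
  then have "h m s - left_lim (h m) s + h (Suc m) s \<le> pattern_weight h m n 1 T"
    using m w[of m] w[of "Suc m"]
    by (simp add: pattern_weight_def sum.atLeast_Suc_atMost T_def left_lim_def[of _ 0])
  then have "ereal (h m s - left_lim (h m) s + h (Suc m) s) \<le> pattern_sup h m n 1 (\<lambda>_. 0) (\<lambda>_. s)"
    unfolding pattern_sup_def by (intro SUP_upper2[OF T]) simp
  also have "\<dots> = pattern_sup g m n 1 (\<lambda>_. 0) (\<lambda>_. s)"
    unfolding hg by (rule pattern_sup_sweeps[OF g m(1)]) auto
  also have "\<dots> \<le> ereal (h m s)"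
    unfolding pattern_sup_def hm
    by (rule SUP_least) (use pitman_sweep_top[OF g _ m(1)] m in auto)
  finally show ?thesis by (simp add: h_def)
qed

lemma iter_pitman_ordered: "f \<in> cadlag_space n \<Longrightarrow> iter_pitman n f \<in> ordered_space n"
  using iter_pitman_cadlag_space iter_pitman_adjacent by (simp add: ordered_space_def)

section \<open>Ordered stacks are fixed and are their own melon\<close>

lemma ordered_cadlag: "f \<in> ordered_space n \<Longrightarrow> f \<in> cadlag_space n"
  by (simp add: ordered_space_def)

lemma pitman_at_ordered:
  assumes f: "f \<in> ordered_space n" and i: "1 \<le> i" "i < n"
  shows "pitman_at i f = f"
proof -
  have lines: "line (f i)" "line (f (Suc i))"
    using ordered_cadlag[OF f] i by (auto simp: cadlag_space_iff)
  have "run_max (f i) (f (Suc i)) = (\<lambda>_. 0)"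
    by (rule run_max_zero[OF lines]) (use f i in \<open>auto simp: ordered_space_def\<close>)
  then show ?thesis by (simp add: pitman_at_run_max[of f, OF lines])
qed

lemma iter_pitman_fixes_ordered:
  assumes "f \<in> ordered_space n" shows "iter_pitman n f = f"
  unfolding iter_pitman_sweeps
  by (rule sweeps_invariant[where P = "\<lambda>g. g = f" and m = 1]) (use assms pitman_at_ordered in auto)

text \<open>
  Counting shared end points repeatedly can only increase the measure, as there are no negative jumps.
\<close>

lemma line_weight_le_separate:
  assumes "interlace k x y" "\<And>a. a < k \<Longrightarrow> 0 \<le> x a" "line g"
  shows "line_weight g k x y \<le> (\<Sum>a<k. g (y a) - left_lim g (x a))"
  using assms(1,2)
proof (induction k)
  case 0
  then show ?case using line_neg[OF assms(3), of "-1"] by (simp add: line_weight_def)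
next
  case (Suc k)
  have "prev y k \<le> x k"
    using Suc.prems Suc.prems(2)[of 0] by (auto simp: interlace_def prev_def split: nat.splits)
  then have "left_lim g (x k) - g (prev y k) \<le> gap g (prev y k) (x k)"
    using line_jump[OF assms(3), of "x k"] by (auto simp: gap_def)
  moreover have "line_weight g k x y \<le> (\<Sum>a<k. g (y a) - left_lim g (x a))"
    using Suc by (simp add: interlace_def)
  ultimately show ?case by (simp add: line_weight_def)
qed

lemma line_weight_drop_trivial:
  assumes "j \<le> k" "\<And>a. j \<le> a \<Longrightarrow> a \<le> k \<Longrightarrow> prev y a = u" "\<And>a. j \<le> a \<Longrightarrow> a < k \<Longrightarrow> x a = u"
  shows "line_weight g k x y = line_weight g j x y"
  using assms
proof (induction k rule: dec_induct)
  case (step k)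
  have "prev y k = u" "prev y (Suc k) = u" "x k = u"
    using step.prems(1)[of k] step.prems(1)[of "Suc k"] step.prems(2)[of k] step.hyps by simp_all
  then have "gap g (prev y k) (x k) = 0" "prev y k = prev y (Suc k)" by (simp_all add: gap_def)
  then show ?case using step by (simp add: line_weight_def)
qed simp

text \<open>
  Where the path switches from line j + 1 to line j at time s, it loses the left limit of \<open>f j\<close>
  and gains \<open>f (j + 1)\<close> at s; by ordering the balance is at most 0.
\<close>

lemma single_path_le_top:
  assumes f: "f \<in> ordered_space n" and "j \<le> n" "1 \<le> j"
    and t: "t n = 0" "\<And>i. j \<le> i \<Longrightarrow> i \<le> n \<Longrightarrow> 0 \<le> t i"
  shows "(\<Sum>i=j..n. f i (t (i - 1)) - left_lim (f i) (t i)) \<le> f j (t (j - 1))"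
  using assms(2,3,5)
proof (induction j rule: inc_induct)
  case base
  then show ?case using t(1) by (simp add: left_lim_def)
next
  case (step j)
  have "f (Suc j) (t j) \<le> left_lim (f j) (t j)"
    using f step by (simp add: ordered_space_def)
  moreover have "(\<Sum>i=Suc j..n. f i (t (i - 1)) - left_lim (f i) (t i)) \<le> f (Suc j) (t j)"
    using step by simp
  ultimately show ?case using step.hyps by (simp add: sum.atLeast_Suc_atMost)
qed

text \<open>
  Since all paths end at the same point, interlacing forces path a (counted from 0) to reach
  time y already on line a + 1.  Up to there it is a single path from time 0, bounded by the value
  of line a + 1 at y; its remaining points belong to other paths.
\<close>

lemma ordered_pattern_weight_le:
  assumes f: "f \<in> ordered_space n" and k: "k \<le> n" "1 \<le> n" and T: "T \<in> patterns 1 n k (\<lambda>_. 0) (\<lambda>_. y)"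
  shows "pattern_weight f 1 n k T \<le> (\<Sum>a<k. f (Suc a) y)"
proof -
  have nonneg: "0 \<le> T i a" if "a < k" "i \<le> n" for i a
    using pattern_nonneg[OF T] that by simp
  have ends: "T n a = 0" "T 0 a = y" if "a < k" for a using T that by (auto simp: patterns_def)
  have final: "T i a = y" if "i \<le> a" "a < k" for i a
    using that
  proof (induction i arbitrary: a)
    case (Suc i)
    then obtain b where b: "a = Suc b" by (cases a) auto
    have "T i b \<le> T (Suc i) a" using pattern_separated[OF T, of b a "Suc i"] Suc.prems k b by simp
    moreover have "T (Suc i) a \<le> T 0 a" using pattern_mono[OF T, of a 0 "Suc i"] Suc.prems k by simp
    ultimately show ?case using Suc b ends(2)[of a] by simp
  qed (simp add: ends)
  define d where "d i a = f i (T (i - 1) a) - left_lim (f i) (T i a)" for i a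
  \<comment> \<open>On line i only the paths a < i can have segments of positive length.\<close>
  have row: "line_weight (f i) k (T i) (T (i - 1)) \<le> (\<Sum>a<k. if a < i then d i a else 0)" if i: "i \<in> {1..n}" for i
  proof -
    let ?j = "min i k"
    have l: "line (f i)" using ordered_cadlag[OF f] i by (simp add: cadlag_space_iff)
    have inter: "interlace k (T i) (T (i - 1))" using T i by (simp add: patterns_def)
    have "line_weight (f i) k (T i) (T (i - 1)) = line_weight (f i) ?j (T i) (T (i - 1))"
    proof (cases "k \<le> i")
      case False
      have "prev (T (i - 1)) a = y" if "i \<le> a" "a \<le> k" for a
        using final[of "i - 1" "a - 1"] that i by (cases a) auto
      then show ?thesis
        using False final by (intro line_weight_drop_trivial[where u = y]) auto
    qed simp
    also have "\<dots> \<le> (\<Sum>a<?j. d i a)"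
      unfolding d_def
      by (rule line_weight_le_separate[OF _ _ l]) (use inter nonneg i in \<open>auto simp: interlace_def\<close>)
    also have "\<dots> = (\<Sum>a<k. if a < i then d i a else 0)"
      by (rule sum.mono_neutral_cong_left) auto
    finally show ?thesis .
  qed
  have "pattern_weight f 1 n k T \<le> (\<Sum>i=1..n. \<Sum>a<k. if a < i then d i a else 0)"
    unfolding pattern_weight_def by (rule sum_mono[OF row])
  also have "\<dots> = (\<Sum>a<k. \<Sum>i=1..n. if a < i then d i a else 0)" by (rule sum.swap)
  also have "\<dots> = (\<Sum>a<k. \<Sum>i=Suc a..n. d i a)"
    by (intro sum.cong[OF refl] sum.mono_neutral_cong_right) auto
  also have "\<dots> \<le> (\<Sum>a<k. f (Suc a) y)"
  proof (rule sum_mono)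
    fix a assume a: "a \<in> {..<k}"
    have "(\<Sum>i=Suc a..n. d i a) \<le> f (Suc a) (T (Suc a - 1) a)"
      unfolding d_def
      by (rule single_path_le_top[OF f, where t = "\<lambda>i. T i a"]) (use a k nonneg ends in auto)
    then show "(\<Sum>i=Suc a..n. d i a) \<le> f (Suc a) y" using final[of a a] a by simp
  qed
  finally show ?thesis .
qed

text \<open>
  The bound is attained by letting path a (counted from 0) stay on line a + 1 throughout; the
  remaining lines are touched only at time 0, where they are nonnegative.
\<close>

lemma ordered_pattern_sup:
  assumes f: "f \<in> ordered_space n" and k: "k \<le> n" "1 \<le> n" and y: "0 \<le> y"
  shows "pattern_sup f 1 n k (\<lambda>_. 0) (\<lambda>_. y) = ereal (\<Sum>a<k. f (Suc a) y)"
proof (rule antisym)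
  show "pattern_sup f 1 n k (\<lambda>_. 0) (\<lambda>_. y) \<le> ereal (\<Sum>a<k. f (Suc a) y)"
    unfolding pattern_sup_def using ordered_pattern_weight_le[OF f k] by (intro SUP_least) simp
  \<comment> \<open>Path a runs along line a + 1, between rows a + 1 (time 0) and a (time y).\<close>
  define T where "T i a = (if i \<le> a then y else 0)" for i a :: nat
  have T: "T \<in> patterns 1 n k (\<lambda>_. 0) (\<lambda>_. y)"
    using y k by (auto simp: patterns_def interlace_def T_def)
  have lines: "line (f i)" if "i \<in> {1..n}" for i using ordered_cadlag[OF f] that by (simp add: cadlag_space_iff)
  have row: "(if i \<le> k then f i y else 0) \<le> line_weight (f i) k (T i) (T (i - 1))" if i: "i \<in> {1..n}" for i
  proof -
    have "gap (f i) (prev (T (i - 1)) a) (T i a) = 0" if "a < k" for a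
      using line_neg[OF lines[OF i], of "-1"] i by (cases a) (auto simp: gap_def T_def left_lim_def)
    then have "line_weight (f i) k (T i) (T (i - 1)) = f i (prev (T (i - 1)) k)"
      by (simp add: line_weight_def)
    also have "(if i \<le> k then f i y else 0) \<le> \<dots>"
      using line_jump[OF lines[OF i], of 0] line_neg[OF lines[OF i], of "-1"] i
      by (cases k) (auto simp: T_def left_lim_def)
    finally show ?thesis .
  qed
  have "(\<Sum>a<k. f (Suc a) y) = (\<Sum>i=1..k. f i y)"
    by (rule sum.reindex_bij_witness[of _ "\<lambda>i. i - 1" Suc]) auto
  also have "\<dots> = (\<Sum>i=1..n. if i \<le> k then f i y else 0)"
    by (rule sum.mono_neutral_cong_left) (use k in auto)
  also have "\<dots> \<le> pattern_weight f 1 n k T"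
    unfolding pattern_weight_def by (rule sum_mono[OF row])
  finally show "ereal (\<Sum>a<k. f (Suc a) y) \<le> pattern_sup f 1 n k (\<lambda>_. 0) (\<lambda>_. y)"
    unfolding pattern_sup_def by (intro SUP_upper2[OF T]) simp
qed

lemma ordered_last_passage:
  assumes f: "f \<in> ordered_space n" and k: "k \<le> n" "1 \<le> n" and y: "0 \<le> y"
  shows "last_passage f (replicate k (0, n)) (replicate k (y, 1)) = ereal (\<Sum>a<k. f (Suc a) y)"
proof -
  have "patterns 1 n k (nth (replicate k 0)) (nth (replicate k y)) = patterns 1 n k (\<lambda>_. 0) (\<lambda>_. y)"
    by (auto simp: patterns_def)
  moreover have "set (replicate k (0::real)) \<subseteq> {0..}" by auto
  ultimately show ?thesis
    using last_passage_patterns[of 1 n "replicate k 0" k "replicate k y" f] ordered_cadlag[OF f] k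
      ordered_pattern_sup[OF f k y]
    by (simp add: cadlag_space_iff pattern_sup_def)
qed

lemma melon_ordered:
  assumes f: "f \<in> ordered_space n"
  shows "melon n f = f"
proof (intro ext)
  fix k y
  show "melon n f k y = f k y"
  proof (cases "1 \<le> k \<and> k \<le> n \<and> 0 \<le> y")
    case True
    then obtain j where "k = Suc j" by (cases k) auto
    then show ?thesis
      using True ordered_last_passage[OF f, of k y] ordered_last_passage[OF f, of j y]
      by (simp add: melon_def)
  next
    case False
    then show ?thesis
      using ordered_cadlag[OF f] unfolding melon_def cadlag_space_def by auto
  qed
qed

lemma isometric_melon:
  assumes "isometric n g f"
  shows "melon n g = melon n f"
proof -
  have "last_passage g (replicate k (0, n)) (replicate k (y, 1)) =
      last_passage f (replicate k (0, n)) (replicate k (y, 1))" if "0 \<le> y" for k and y :: real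
    using assms[unfolded isometric_def, rule_format, of "replicate k 0" "replicate k y"] that
    by (simp add: set_replicate_conv_if)
  then show ?thesis by (auto simp: melon_def fun_eq_iff)
qed

theorem proposition3p12:
  fixes n :: nat
  shows "(\<forall>f\<in>cadlag_space n. isometric n (iter_pitman n f) f) \<and>
         (\<forall>f\<in>cadlag_space n. iter_pitman n (iter_pitman n f) = iter_pitman n f) \<and>
         iter_pitman n ` cadlag_space n = ordered_space n \<and>
         (\<forall>f\<in>cadlag_space n. iter_pitman n f = melon n f)"
proof (intro conjI ballI)
  fix f assume f: "f \<in> cadlag_space n"
  show iso: "isometric n (iter_pitman n f) f" by (rule iter_pitman_isometric[OF f])
  show "iter_pitman n (iter_pitman n f) = iter_pitman n f"
    by (rule iter_pitman_fixes_ordered[OF iter_pitman_ordered[OF f]])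
  show "iter_pitman n f = melon n f"
    using melon_ordered[OF iter_pitman_ordered[OF f]] isometric_melon[OF iso] by simp
next
  have "f \<in> iter_pitman n ` cadlag_space n" if "f \<in> ordered_space n" for f
    using iter_pitman_fixes_ordered[OF that] ordered_cadlag[OF that] by (metis imageI)
  then show "iter_pitman n ` cadlag_space n = ordered_space n"
    using iter_pitman_ordered by blast
qed

end
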